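(* Let $\boldsymbol{\omega}=(\omega_1,\omega_2,\dots)$ with $\Re\omega_j>0$ for all $j$, let $f$ be an LLD meromorphic function on $\mathbb{C}$ of finite order with $f(1)=1$, and let $N\ge1$. Assume that for $1\le n\le N$, $$[\mathbb{Q}[\omega_1,\dots,\omega_n]:\mathbb{Q}[\omega_1,\dots,\omega_{n-1}]]\ge n+1.$$ If $(g_n(s|\boldsymbol{\omega}_n))_{n\ge0}$ and $(\tilde g_n(s|\boldsymbol{\omega}_n))_{n\ge0}$ are two normalized general multiple Gamma hierarchies associated to $f$ such that $g_N(r|\boldsymbol{\omega}_N)=\tilde g_N(r|\boldsymbol{\omega}_N)$ for some rational $r>0$, $r\neq1$, then $g_n=\tilde g_n$ for all $1\le n\le N$. (That is, the hierarchy up to level $N$ is uniquely determined by the value $\Gamma^f_N(r|\boldsymbol{\omega}_N)$.)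
   Context: LLD: no zeros nor poles in $\{\Re s>0\}$. Finite order: quotient of entire functions of finite order. $\boldsymbol{\omega}_n=(\omega_1,\dots,\omega_n)$. The bracket $[\,\cdot:\cdot\,]$ denotes the degree of the extension generated by adjoining $\omega_n$ to $\mathbb{Q}[\omega_1,\dots,\omega_{n-1}]$ (possibly infinite, e.g. if $\omega_n$ is transcendental over it). A normalized general multiple Gamma hierarchy associated to $f$ is a sequence $(\Gamma^f_n(s|\boldsymbol{\omega}_n))_{n\ge0}$ with $\Gamma^f_0(s)=f(s)^{-1}$, $\Gamma^f_{n+1}(s+\omega_{n+1}|\boldsymbol{\omega}_{n+1})=\Gamma^f_n(s|\boldsymbol{\omega}_n)^{-1}\Gamma^f_{n+1}(s|\boldsymbol{\omega}_{n+1})$ for $n\ge0$, each $\Gamma^f_n(\cdot|\boldsymbol{\omega}_n)$ meromorphic of finite order and LLD, and $\Gamma^f_n(1|\boldsymbol{\omega}_n)=1$ for $n\ge1$. *)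

theory Defs
  imports "HOL-Complex_Analysis.Complex_Analysis" "HOL-Computational_Algebra.Polynomial"
begin

text \<open>Meromorphic functions on C are represented by total functions complex => complex;
 equalities between meromorphic functions are understood away from a discrete set
 (eventually w.r.t. the cosparse filter on UNIV).\<close>

definition entire_finite_order :: "(complex \<Rightarrow> complex) \<Rightarrow> bool" where
  "entire_finite_order h \<longleftrightarrow> h holomorphic_on UNIV \<and>
     (\<exists>\<rho> A. \<forall>z. norm (h z) \<le> A * exp (norm z powr \<rho>))"

definition mero_finite_order :: "(complex \<Rightarrow> complex) \<Rightarrow> bool" where
  "mero_finite_order f \<longleftrightarrow> f meromorphic_on UNIV \<and>
     (\<exists>h1 h2. entire_finite_order h1 \<and> entire_finite_order h2 \<and> (\<exists>z. h2 z \<noteq> 0) \<and>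
        (\<forall>\<^sub>\<approx>z. f z = h1 z / h2 z))"

definition LLD :: "(complex \<Rightarrow> complex) \<Rightarrow> bool" where
  "LLD f \<longleftrightarrow> f holomorphic_on {s. Re s > 0} \<and> (\<forall>s. Re s > 0 \<longrightarrow> f s \<noteq> 0)"

definition ring_adjoin :: "complex set \<Rightarrow> complex \<Rightarrow> complex set" where
  "ring_adjoin K a = {poly p a | p. \<forall>i. coeff p i \<in> K}"

text \<open>Q[omega_1,...,omega_n] (omega indexed from 1; omega 0 is unused).\<close>
fun Qadj :: "(nat \<Rightarrow> complex) \<Rightarrow> nat \<Rightarrow> complex set" where
  "Qadj \<omega> 0 = \<rat>"
| "Qadj \<omega> (Suc n) = ring_adjoin (Qadj \<omega> n) (\<omega> (Suc n))"

definition lin_indep_over :: "complex set \<Rightarrow> complex set \<Rightarrow> bool" where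
  "lin_indep_over K B \<longleftrightarrow> (\<forall>c. (\<forall>x\<in>B. c x \<in> K) \<and> (\<Sum>x\<in>B. c x * x) = 0 \<longrightarrow> (\<forall>x\<in>B. c x = 0))"

text \<open>[K[a] : K] >= m (the degree may be infinite): K[a] contains m elements
 linearly independent over K.\<close>
definition ext_degree_ge :: "complex set \<Rightarrow> complex \<Rightarrow> nat \<Rightarrow> bool" where
  "ext_degree_ge K a m \<longleftrightarrow> (\<exists>B. B \<subseteq> ring_adjoin K a \<and> finite B \<and> card B = m \<and> lin_indep_over K B)"

definition gamma_hierarchy :: "(complex \<Rightarrow> complex) \<Rightarrow> (nat \<Rightarrow> complex) \<Rightarrow> (nat \<Rightarrow> complex \<Rightarrow> complex) \<Rightarrow> bool" where
  "gamma_hierarchy f \<omega> g \<longleftrightarrow>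
     (\<forall>\<^sub>\<approx>s. g 0 s = inverse (f s)) \<and>
     (\<forall>n. \<forall>\<^sub>\<approx>s. g (Suc n) (s + \<omega> (Suc n)) = inverse (g n s) * g (Suc n) s) \<and>
     (\<forall>n. mero_finite_order (g n) \<and> LLD (g n)) \<and>
     (\<forall>n\<ge>1. g n 1 = 1)"

end

theory Submission
  imports Defs
begin

text \<open>
  On the right half-plane, \<open>g\<^sub>n / g'\<^sub>n = exp H\<close> with \<open>H\<close> holomorphic. If
  \<open>g\<^sub>n\<^sub>-\<^sub>1 / g'\<^sub>n\<^sub>-\<^sub>1\<close> is the exponential of a polynomial, the recursion prescribes the difference
  \<open>H (s + \<omega>\<^sub>n) - H s\<close> up to a constant in \<open>2 \<pi> \<i> \<int>\<close>, so that \<open>H\<close> minus a polynomial is periodic and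
  extends to an entire function; as \<open>exp H\<close> is a quotient of entire functions of finite order,
  \<open>H\<close> is a polynomial. Thus \<open>g\<^sub>n / g'\<^sub>n = exp (2 \<pi> \<i> q\<^sub>n)\<close> with polynomials satisfying
  \<open>q\<^sub>n(1) = 0\<close> and \<open>q\<^sub>n(s + \<omega>\<^sub>n) - q\<^sub>n(s) = R(s)\<close>, where \<open>R = k\<^sub>n - q\<^sub>n\<^sub>-\<^sub>1\<close> and \<open>k\<^sub>n\<close> is an integer.

  Solving this equation by Bernoulli polynomials shows that \<open>\<omega>\<^sub>n q\<^sub>n(r)\<close> is a polynomial in \<open>\<omega>\<^sub>n\<close> of
  degree at most \<open>n\<close> over the field generated by \<open>\<omega>\<^sub>1, \<dots>, \<omega>\<^sub>n\<^sub>-\<^sub>1\<close>, with constant coefficient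
  \<open>\<integral>\<^sub>1\<^sup>r R\<close> and linear coefficient \<open>- (R(r) - R(1)) / 2 = q\<^sub>n\<^sub>-\<^sub>1(r) / 2\<close>. If \<open>q\<^sub>n(r)\<close> is an integer
  \<open>m\<close>, the degree condition allows comparing coefficients with \<open>m \<omega>\<^sub>n\<close>: the linear one gives
  \<open>q\<^sub>n\<^sub>-\<^sub>1(r) = 2 m\<close>, so \<open>q\<^sub>n\<^sub>-\<^sub>1 = 0\<close> by induction, and then the constant one gives
  \<open>k\<^sub>n (r - 1) = 0\<close>.
\<close>

section \<open>Zero-free quotients of entire functions of finite order\<close>

text \<open>For \<open>k > K - Re (f 0)\<close> the map u / (2 k - u) sends the half-plane Re u < k
  into the unit disc and fixes 0, so the Schwarz lemma applies to \<open>\<phi>\<close>; at modulus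
  at most 1/2 its bound can be solved for \<open>norm (f z - f 0)\<close>. Finally \<open>k\<close>
  tends to its lower limit.\<close>

lemma borel_caratheodory:
  fixes f :: "complex \<Rightarrow> complex"
  assumes hol: "f holomorphic_on ball 0 r" and r: "r > 0"
    and le: "\<And>z. z \<in> ball 0 r \<Longrightarrow> Re (f z) \<le> K" and z: "norm z \<le> r / 2"
  shows "norm (f z - f 0) \<le> 2 * (K - Re (f 0))"
proof -
  have bound: "norm (f z - f 0) \<le> 2 * k" if k: "K - Re (f 0) < k" for k
  proof -
    have k0: "k > 0" using le[of 0] r k by auto
    define \<phi> where "\<phi> = (\<lambda>w::complex. (f (r * w) - f 0) / (2 * k - (f (r * w) - f 0)))"
    have lt: "norm (f (r * w) - f 0) < norm (2 * k - (f (r * w) - f 0))" if w: "norm w < 1" for w :: complex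
    proof -
      define u where "u = f (r * w) - f 0"
      have "r * w \<in> ball 0 r" using r w by (simp add: norm_mult)
      then have "Re u < k" using le[of "r * w"] k by (simp add: u_def)
      then have "(Re u)\<^sup>2 < (2 * k - Re u)\<^sup>2"
        using k0 by (simp add: power2_eq_square algebra_simps) 
      then have "(norm u)\<^sup>2 < (norm (2 * k - u))\<^sup>2"
        by (simp add: cmod_power2)
      then show ?thesis unfolding u_def by (rule power_less_imp_less_base) simp
    qed
    have nz: "2 * k - (f (r * w) - f 0) \<noteq> 0" if "norm w < 1" for w :: complex
      using lt[OF that] by (metis norm_ge_zero norm_zero not_le)
    have ball: "(\<lambda>w. of_real r * w) ` ball 0 1 \<subseteq> ball (0::complex) r" using r by (auto simp: norm_mult)
    have "(f \<circ> (\<lambda>w. of_real r * w)) holomorphic_on ball 0 1"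
      by (rule holomorphic_on_compose_gen[OF _ hol]) (use ball in \<open>auto intro!: holomorphic_intros\<close>)
    then have "(\<lambda>w. f (r * w)) holomorphic_on ball 0 1" by (simp add: o_def)
    then have hol': "\<phi> holomorphic_on ball 0 1"
      unfolding \<phi>_def by (intro holomorphic_intros) (use nz in auto)
    have small: "norm (\<phi> w) < 1" if "norm w < 1" for w :: complex
      using lt[OF that] nz[OF that] by (simp add: \<phi>_def norm_divide)
    define w where "w = z / r"
    have nw: "norm w \<le> 1 / 2" using z r by (simp add: w_def norm_divide field_simps)
    have zw: "r * w = z" using r by (simp add: w_def)
    have "norm (\<phi> w) \<le> norm w"
      by (rule Schwarz_Lemma(1)[OF hol']) (use nw small in \<open>auto simp: \<phi>_def\<close>)
    then have "norm (f z - f 0) \<le> norm w * norm (2 * k - (f z - f 0))"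
      using nz[of w] nw by (simp add: \<phi>_def zw norm_divide pos_divide_le_eq)
    also have "\<dots> \<le> 1/2 * (2 * k + norm (f z - f 0))"
    proof (rule mult_mono[OF nw])
      show "norm (2 * k - (f z - f 0)) \<le> 2 * k + norm (f z - f 0)"
        using norm_triangle_ineq4[of "2 * complex_of_real k" "f z - f 0"] k0 by simp
    qed auto
    finally show ?thesis by simp
  qed
  show ?thesis
  proof (rule field_le_epsilon)
    fix e :: real assume "e > 0"
    then show "norm (f z - f 0) \<le> 2 * (K - Re (f 0)) + e"
      using bound[of "K - Re (f 0) + e / 2"] by simp
  qed
qed

lemma entire_maximum_modulus:
  assumes "f holomorphic_on UNIV" and "\<And>z. norm z = R \<Longrightarrow> norm (f z) \<le> B" and "norm z \<le> R"
  shows "norm (f z) \<le> B"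
proof (rule maximum_modulus_frontier[of f "cball 0 R"])
  show "f holomorphic_on interior (cball 0 R)" "continuous_on (closure (cball 0 R)) f"
    using assms(1) holomorphic_on_subset holomorphic_on_imp_continuous_on
    by (blast intro: continuous_on_subset)+
qed (use assms in \<open>auto simp: frontier_def\<close>)

text \<open>Multiplying \<open>A\<close> by the inverse Blaschke factor of one of its zeros keeps \<open>A\<close> entire and
  changes neither bound on the circle. If the zero lies in the disc of radius \<open>R / 2\<close>, this at
  least doubles \<open>norm (A 0)\<close>, hence the induction on \<open>k\<close>. Once no zeros are left there, applying
  the Borel--Caratheodory theorem to a logarithm bounds \<open>A\<close> from below.\<close>
lemma entire_quotient_bound:
  fixes A E :: "complex \<Rightarrow> complex"
  assumes E: "E holomorphic_on UNIV" and R: "R > 0" and M: "M > 0"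
    and A: "A holomorphic_on UNIV" "A 0 \<noteq> 0" "M \<le> 2 ^ k * norm (A 0)"
    and bounds: "\<And>z. norm z = R \<Longrightarrow> norm (A z) \<le> M" "\<And>z. norm z = R \<Longrightarrow> norm (E z * A z) \<le> M"
    and z: "norm z \<le> R / 4"
  shows "norm (E z) \<le> (M / norm (A 0)) ^ 3"
  using A bounds
proof (induction k arbitrary: A rule: less_induct)
  case IH: (less k)
  show ?case
  proof (cases "\<exists>a. norm a < R / 2 \<and> A a = 0")
    case True
    then obtain a where a: "norm a < R / 2" "A a = 0" by blast
    have a0: "a \<noteq> 0" using a IH.prems by auto
    define D where "D = (\<lambda>z. if z = a then deriv A a else A z / (z - a))"
    have D: "D holomorphic_on UNIV"
      by (rule pole_theorem_open_0[OF IH.prems(1), of a]) (auto simp: D_def a)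
    have Dz: "A z = (z - a) * D z" for z using a by (simp add: D_def)
    define A1 where "A1 = (\<lambda>z. D z * (R\<^sup>2 - cnj a * z) / R)"
    have A1: "A1 holomorphic_on UNIV"
      unfolding A1_def by (intro holomorphic_intros D) (use R in auto)
    have "norm (A 0) = norm a * norm (D 0)" by (simp add: Dz norm_mult)
    moreover have "norm (A1 0) = norm (D 0) * R"
      using R by (simp add: A1_def norm_mult norm_divide norm_power power2_eq_square)
    ultimately have "norm (A1 0) = norm (A 0) * (R / norm a)" using a0 by simp
    moreover have "R / norm a \<ge> 2" using a a0 by (simp add: field_simps)
    ultimately have A10: "norm (A1 0) \<ge> norm (A 0) * 2"
      using mult_left_mono[of 2 "R / norm a" "norm (A 0)"] by simp
    have sphere: "norm (A1 w) = norm (A w)" if w: "norm w = R" for w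
    proof -
      have "R\<^sup>2 - cnj a * w = cnj (w - a) * w"
        using w complex_norm_square[of w] by (simp add: algebra_simps)
      then have "norm (R\<^sup>2 - cnj a * w) = norm (w - a) * R"
        using w by (simp only: norm_mult complex_mod_cnj)
      then show ?thesis using R by (simp add: A1_def Dz norm_mult norm_divide)
    qed
    have bd: "norm (A1 w) \<le> M" "norm (E w * A1 w) \<le> M" if "norm w = R" for w
      using sphere[OF that] IH.prems(4,5)[OF that] by (auto simp: norm_mult)
    have "norm (A1 0) \<le> M"
      by (rule entire_maximum_modulus[OF A1, of R]) (use bd R in auto)
    have pos: "norm (A 0) > 0" using IH.prems by simp
    show ?thesis
    proof (cases k)
      case 0
      \<comment> \<open>Impossible case: \<open>norm (A1 0)\<close> is at most \<open>M\<close>,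
        hence at most \<open>norm (A 0)\<close>, yet at least twice
        \<open>norm (A 0)\<close>.\<close>
      then show ?thesis using IH.prems(3) A10 \<open>norm (A1 0) \<le> M\<close> pos by simp
    next
      case (Suc j)
      have "M \<le> 2 ^ j * (norm (A 0) * 2)" using IH.prems(3) Suc by simp
      also have "\<dots> \<le> 2 ^ j * norm (A1 0)" using A10 by simp
      finally have "norm (E z) \<le> (M / norm (A1 0)) ^ 3"
        by (intro IH.IH[of j]) (use Suc A1 bd pos A10 in auto)
      also have "\<dots> \<le> (M / norm (A 0)) ^ 3"
      proof (intro power_mono divide_left_mono mult_pos_pos)
        show "norm (A 0) \<le> norm (A1 0)" "norm (A1 0) > 0" using A10 pos by linarith+
      qed (use M pos in auto)
      finally show ?thesis .
    qed
  next
    case False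
    then have nz: "A w \<noteq> 0" if "w \<in> ball 0 (R / 2)" for w using that by auto
    obtain L where L: "L holomorphic_on ball 0 (R / 2)"
      "\<And>w. w \<in> ball 0 (R / 2) \<Longrightarrow> exp (L w) = A w"
      by (rule holomorphic_logarithm_exists[of "ball 0 (R / 2)" A 0])
        (use nz R IH.prems(1) holomorphic_on_subset in auto)
    have le: "norm (A w) \<le> M" if "norm w \<le> R" for w
      by (rule entire_maximum_modulus[OF IH.prems(1) _ that]) (use IH.prems in auto)
    have Re: "Re (L w) = ln (norm (A w))" if "w \<in> ball 0 (R / 2)" for w
      using L(2)[OF that, symmetric] by simp
    have "norm (L z - L 0) \<le> 2 * (ln M - Re (L 0))"
    proof (rule borel_caratheodory[OF L(1)])
      fix w :: complex assume w: "w \<in> ball 0 (R / 2)"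
      then have "norm (A w) > 0" "norm (A w) \<le> M" using nz[OF w] le[of w] R by auto
      then show "Re (L w) \<le> ln M" using M by (simp add: Re[OF w])
    qed (use R z in auto)
    \<comment> \<open>The real part drops by at most \<open>2 * (ln M - Re (L 0))\<close>. This
      yields the lower bound |A(0)|^3 / M^2 for |A(z)|; dividing the bound \<open>M\<close> for
      \<open>E * A\<close> by it produces the cube.\<close>
    then have "Re (L z) \<ge> 3 * Re (L 0) - 2 * ln M"
      using abs_Re_le_cmod[of "L z - L 0"] by simp
    then have "exp (3 * Re (L 0) - 2 * ln M) \<le> norm (A z)"
      using L(2)[of z, symmetric] z R by simp
    also have "exp (3 * Re (L 0) - 2 * ln M) = norm (A 0) ^ 3 / M ^ 2"
    proof -
      have "exp (3 * Re (L 0)) = norm (A 0) ^ 3"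
        using L(2)[of 0, symmetric] R exp_of_nat_mult[of 3 "Re (L 0)"] by simp
      moreover have "exp (2 * ln M) = M ^ 2"
        using M exp_of_nat_mult[of 2 "ln M"] by simp
      ultimately show ?thesis by (simp add: exp_diff)
    qed
    finally have lower: "norm (A 0) ^ 3 / M ^ 2 \<le> norm (A z)" .
    have "norm (E z * A z) \<le> M"
      by (rule entire_maximum_modulus[of "\<lambda>z. E z * A z" R])
        (use IH.prems E R z in \<open>auto intro!: holomorphic_intros\<close>)
    then have "norm (E z) * (norm (A 0) ^ 3 / M ^ 2) \<le> M"
      using mult_left_mono[OF lower, of "norm (E z)"] by (simp add: norm_mult)
    then show ?thesis using M IH.prems(2)
      by (simp add: field_simps power2_eq_square power3_eq_cube)
  qed
qed

section \<open>Growth of entire functions of finite order\<close>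

lemma entire_finite_order_growth:
  assumes "entire_finite_order h"
  obtains C k where "C \<ge> 0" "\<And>R z. R \<ge> 1 \<Longrightarrow> norm z \<le> R \<Longrightarrow> norm (h z) \<le> exp (C * R ^ k)"
proof -
  obtain \<rho> A where h: "h holomorphic_on UNIV" "\<And>z. norm (h z) \<le> A * exp (norm z powr \<rho>)"
    using assms by (auto simp: entire_finite_order_def)
  define k where "k = nat \<lceil>\<rho>\<rceil>"
  have \<rho>k: "\<rho> \<le> real k" unfolding k_def by linarith
  show thesis
  proof (rule that[of "\<bar>A\<bar> + 1" k])
    fix R :: real and z :: complex assume R: "R \<ge> 1" and z: "norm z \<le> R"
    \<comment> \<open>Only the circle of radius \<open>R\<close> is estimated directly, because the
      given bound need not increase with \<open>norm z\<close>: the exponent \<open>\<rho>\<close>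
      may be negative.\<close>
    show "norm (h z) \<le> exp ((\<bar>A\<bar> + 1) * R ^ k)"
    proof (rule entire_maximum_modulus[OF h(1) _ z])
      fix w :: complex assume w: "norm w = R"
      have "norm w powr \<rho> \<le> R ^ k"
        using R \<rho>k powr_mono[of \<rho> k R] by (simp add: w powr_realpow)
      have "norm (h w) \<le> A * exp (norm w powr \<rho>)" by (rule h)
      also have "\<dots> \<le> \<bar>A\<bar> * exp (R ^ k)"
        using \<open>norm w powr \<rho> \<le> R ^ k\<close> by (intro mult_mono) auto
      also have "\<dots> \<le> exp \<bar>A\<bar> * exp (R ^ k)"
        using exp_ge_add_one_self[of "\<bar>A\<bar>"] by (intro mult_right_mono) (linarith | simp)+
      also have "\<dots> \<le> exp ((\<bar>A\<bar> + 1) * R ^ k)"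
        using R mult_left_mono[of 1 "R ^ k" "\<bar>A\<bar>"] by (simp flip: exp_add add: algebra_simps)
      finally show "norm (h w) \<le> exp ((\<bar>A\<bar> + 1) * R ^ k)" .
    qed
  qed auto
qed

lemma entire_finite_orderI:
  assumes h: "h holomorphic_on UNIV"
    and growth: "\<And>R z. R \<ge> 1 \<Longrightarrow> norm z \<le> R \<Longrightarrow> norm (h z) \<le> exp (C * R ^ k)"
  shows "entire_finite_order h"
proof -
  \<comment> \<open>Outside the disc of radius \<open>D\<close> one extra power of
    \<open>norm z\<close> absorbs \<open>C\<close>; inside it a constant factor suffices.\<close>
  define D where "D = \<bar>C\<bar> + 1"
  have D: "D \<ge> 1" "C \<le> D" by (auto simp: D_def)
  have "norm (h z) \<le> exp (\<bar>C\<bar> * D ^ k) * exp (norm z powr real (Suc k))" for z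
  proof (cases "norm z \<le> D")
    case True
    then have "norm (h z) \<le> exp (C * D ^ k) * 1" using growth[OF D(1)] by simp
    also have "\<dots> \<le> exp (\<bar>C\<bar> * D ^ k) * 1" using D by (simp add: mult_right_mono)
    also have "\<dots> \<le> exp (\<bar>C\<bar> * D ^ k) * exp (norm z powr real (Suc k))"
      by (intro mult_left_mono) auto
    finally show ?thesis .
  next
    case False
    then have z: "norm z \<ge> 1" "C \<le> norm z" using D by auto
    have "norm (h z) \<le> exp (C * norm z ^ k)" using growth[of "norm z" z] z by simp
    also have "C * norm z ^ k \<le> norm z ^ Suc k" using z by (simp add: mult_right_mono)
    also have "norm z ^ Suc k = norm z powr real (Suc k)"
      by (rule powr_realpow[symmetric]) (use z in linarith)
    also have "exp (norm z powr real (Suc k)) \<le> exp (\<bar>C\<bar> * D ^ k) * exp (norm z powr real (Suc k))"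
      using D by simp
    finally show ?thesis by simp
  qed
  then show ?thesis unfolding entire_finite_order_def using h by blast
qed

lemma entire_finite_order_mult:
  assumes f: "entire_finite_order f" and g: "entire_finite_order g"
  shows "entire_finite_order (\<lambda>z. f z * g z)"
proof -
  obtain C1 k1 where 1: "C1 \<ge> 0" "\<And>R z. R \<ge> 1 \<Longrightarrow> norm z \<le> R \<Longrightarrow> norm (f z) \<le> exp (C1 * R ^ k1)"
    using entire_finite_order_growth[OF f] by blast
  obtain C2 k2 where 2: "C2 \<ge> 0" "\<And>R z. R \<ge> 1 \<Longrightarrow> norm z \<le> R \<Longrightarrow> norm (g z) \<le> exp (C2 * R ^ k2)"
    using entire_finite_order_growth[OF g] by blast
  show ?thesis
  proof (rule entire_finite_orderI[of _ "C1 + C2" "k1 + k2"])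
    show "(\<lambda>z. f z * g z) holomorphic_on UNIV"
      using f g by (auto simp: entire_finite_order_def intro!: holomorphic_intros)
    fix R :: real and z :: complex assume R: "R \<ge> 1" and z: "norm z \<le> R"
    have "norm (f z * g z) \<le> exp (C1 * R ^ k1) * exp (C2 * R ^ k2)"
      unfolding norm_mult by (intro mult_mono 1 2 R z) auto
    also have "\<dots> = exp (C1 * R ^ k1 + C2 * R ^ k2)" by (simp add: exp_add)
    also have "C1 * R ^ k1 + C2 * R ^ k2 \<le> C1 * R ^ (k1 + k2) + C2 * R ^ (k1 + k2)"
      by (intro add_mono mult_left_mono power_increasing R 1 2) auto
    finally show "norm (f z * g z) \<le> exp ((C1 + C2) * R ^ (k1 + k2))"
      by (simp add: algebra_simps)
  qed
qed

text \<open>After a translation that makes \<open>A\<close> nonzero at 0,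
  \<open>entire_quotient_bound\<close> bounds the real part of \<open>F\<close> above by a
  polynomial in the radius. Borel-Caratheodory turns this into a bound on \<open>norm (F z)\<close>,
  and Liouville's theorem for polynomial growth finishes.\<close>

lemma exp_quotient_finite_order_imp_poly:
  fixes A B F :: "complex \<Rightarrow> complex"
  assumes A: "entire_finite_order A" "A c \<noteq> 0" and B: "entire_finite_order B"
    and F: "F holomorphic_on UNIV" and eq: "\<And>z. exp (F z) * A z = B z"
  obtains p where "\<And>z. F z = poly p z"
proof -
  obtain C1 k1 where 1: "C1 \<ge> 0" "\<And>R z. R \<ge> 1 \<Longrightarrow> norm z \<le> R \<Longrightarrow> norm (A z) \<le> exp (C1 * R ^ k1)"
    using entire_finite_order_growth[OF A(1)] by blast
  obtain C2 k2 where 2: "C2 \<ge> 0" "\<And>R z. R \<ge> 1 \<Longrightarrow> norm z \<le> R \<Longrightarrow> norm (B z) \<le> exp (C2 * R ^ k2)"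
    using entire_finite_order_growth[OF B] by blast
  define k where "k = k1 + k2"
  \<comment> \<open>If \<open>norm z = R\<close> and \<open>R \<ge> 1\<close>, then
    \<open>norm (z + c)\<close> is at most \<open>c' * R\<close>; \<open>K\<close> absorbs this
    factor for both \<open>A\<close> and \<open>B\<close>.\<close>
  define c' where "c' = 1 + norm c"
  define K where "K = (C1 + C2) * c' ^ k"
  have c': "c' \<ge> 1" by (simp add: c'_def)
  have K: "K \<ge> 0" using 1 2 c' by (simp add: K_def)
  define A' F' where "A' = (\<lambda>z. A (z + c))" and "F' = (\<lambda>z. F (z + c))"
  have comp: "(\<lambda>z. h (z + c)) holomorphic_on UNIV" if "h holomorphic_on UNIV" for h :: "complex \<Rightarrow> complex"
    using holomorphic_on_compose_gen[of "\<lambda>z. z + c" UNIV h UNIV, OF _ that]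
    by (simp add: o_def holomorphic_intros)
  have hol: "A' holomorphic_on UNIV" "F' holomorphic_on UNIV"
    unfolding A'_def F'_def using A F by (auto simp: entire_finite_order_def intro: comp)
  have bound: "norm (A' z) \<le> exp (K * R ^ k)" "norm (exp (F' z) * A' z) \<le> exp (K * R ^ k)"
    if R: "R \<ge> 1" and z: "norm z = R" for R z
  proof -
    have cR: "c' * R \<ge> 1" using mult_mono[OF c' R] c' by simp
    have "norm (z + c) \<le> R + norm c * 1" using norm_triangle_ineq[of z c] z by simp
    also have "\<dots> \<le> R + norm c * R" by (intro add_left_mono mult_left_mono R) auto
    finally have zc: "norm (z + c) \<le> c' * R" by (simp add: c'_def algebra_simps)
    have pow: "C1 * (c' * R) ^ k1 \<le> K * R ^ k" "C2 * (c' * R) ^ k2 \<le> K * R ^ k"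
      unfolding K_def mult.assoc power_mult_distrib[symmetric]
      by (intro mult_mono power_increasing cR; use 1 2 cR in \<open>auto simp: k_def\<close>)+
    show "norm (A' z) \<le> exp (K * R ^ k)"
      unfolding A'_def by (rule order.trans[OF 1(2)[OF cR zc]]) (use pow in simp)
    show "norm (exp (F' z) * A' z) \<le> exp (K * R ^ k)"
      unfolding A'_def F'_def eq by (rule order.trans[OF 2(2)[OF cR zc]]) (use pow in simp)
  qed
  define a where "a = ln (norm (A' 0))"
  have A'0: "A' 0 \<noteq> 0" using A by (simp add: A'_def)
  have ReF: "Re (F' z) \<le> 3 * (K * R ^ k - a)" if R: "R \<ge> 1" and z: "norm z \<le> R / 4" for R z
  proof -
    \<comment> \<open>The number of doublings does not enter the resulting estimate, so any large
      enough \<open>m\<close> will do.\<close>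
    obtain m where "exp (K * R ^ k) / norm (A' 0) < 2 ^ m"
      using real_arch_pow[of 2] by auto
    then have m: "exp (K * R ^ k) \<le> 2 ^ m * norm (A' 0)" using A'0 by (simp add: field_simps)
    have "norm (exp (F' z)) \<le> (exp (K * R ^ k) / norm (A' 0)) ^ 3"
      by (rule entire_quotient_bound[OF _ _ _ hol(1) A'0 m])
        (use R hol bound z in \<open>auto intro!: holomorphic_intros\<close>)
    also have "exp (K * R ^ k) / norm (A' 0) = exp (K * R ^ k - a)"
      using A'0 by (simp add: a_def exp_diff)
    also have "\<dots> ^ 3 = exp (3 * (K * R ^ k - a))"
      using exp_of_nat_mult[of 3 "K * R ^ k - a"] by simp
    finally show ?thesis by simp
  qed
  define D where "D = 6 * K * 8 ^ k + 6 * \<bar>a\<bar> + 3 * norm (F' 0)"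
  have F'bound: "norm (F' z) \<le> D * norm z ^ k" if z: "1 \<le> norm z" for z
  proof -
    \<comment> \<open>\<open>ReF\<close> covers the disc of radius
      \<open>R / 4 = 2 * norm z\<close>, and \<open>z\<close> sits at half that radius, as
      \<open>borel_caratheodory\<close> demands.\<close>
    define R where "R = 8 * norm z"
    have R: "R \<ge> 1" using z by (simp add: R_def)
    have "norm (F' z - F' 0) \<le> 2 * (3 * (K * R ^ k - a) - Re (F' 0))"
    proof (rule borel_caratheodory[of _ "R / 4"])
      show "Re (F' w) \<le> 3 * (K * R ^ k - a)" if "w \<in> ball 0 (R / 4)" for w
        using ReF[OF R, of w] that by simp
    qed (use z hol(2) holomorphic_on_subset in \<open>auto simp: R_def\<close>)
    then have "norm (F' z) \<le> 2 * (3 * (K * R ^ k - a) - Re (F' 0)) + norm (F' 0)"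
      using norm_triangle_sub[of "F' z" "F' 0"] by linarith
    also have "\<dots> \<le> 6 * K * R ^ k + (6 * \<bar>a\<bar> + 3 * norm (F' 0)) * 1"
      using abs_Re_le_cmod[of "F' 0"] by (simp add: abs_if algebra_simps split: if_splits)
    also have "\<dots> \<le> 6 * K * R ^ k + (6 * \<bar>a\<bar> + 3 * norm (F' 0)) * norm z ^ k"
      using z by (intro add_left_mono mult_left_mono one_le_power) auto
    also have "\<dots> = D * norm z ^ k" by (simp add: D_def R_def power_mult_distrib algebra_simps)
    finally show ?thesis .
  qed
  define q where "q = (\<Sum>i\<le>k. monom ((deriv ^^ i) F' 0 / fact i) i)"
  have q: "F' z = poly q z" for z
    unfolding q_def using Liouville_polynomial[OF hol(2) F'bound, where \<xi> = z]
    by (simp add: poly_sum poly_monom)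
  show thesis
  proof (rule that)
    show "F z = poly (pcompose q [:- c, 1:]) z" for z
      using q[of "z - c"] by (simp add: F'_def poly_pcompose)
  qed
qed

section \<open>Linear independence of powers\<close>

text \<open>The degree condition concerns rings that need not be fields, whereas elimination needs
  division. For a subring \<open>K\<close> this is its field of fractions inside the complex
  numbers.\<close>

definition frac_set :: "complex set \<Rightarrow> complex set" where
  "frac_set K = {x / y | x y. x \<in> K \<and> y \<in> K \<and> y \<noteq> 0}"

locale complex_subring =
  fixes K :: "complex set"
  assumes one_mem: "1 \<in> K"
    and diff_mem: "x \<in> K \<Longrightarrow> y \<in> K \<Longrightarrow> x - y \<in> K"
    and mult_mem: "x \<in> K \<Longrightarrow> y \<in> K \<Longrightarrow> x * y \<in> K"
begin

lemma zero_mem: "0 \<in> K" using diff_mem[OF one_mem one_mem] by simp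
lemma uminus_mem: "x \<in> K \<Longrightarrow> - x \<in> K" using diff_mem[OF zero_mem] by simp
lemma add_mem: "x \<in> K \<Longrightarrow> y \<in> K \<Longrightarrow> x + y \<in> K" using diff_mem[OF _ uminus_mem] by fastforce
lemma sum_mem: "(\<And>i. i \<in> I \<Longrightarrow> f i \<in> K) \<Longrightarrow> sum f I \<in> K"
  by (induction I rule: infinite_finite_induct) (auto intro: zero_mem add_mem)
lemma prod_mem: "(\<And>i. i \<in> I \<Longrightarrow> f i \<in> K) \<Longrightarrow> prod f I \<in> K"
  by (induction I rule: infinite_finite_induct) (auto intro: one_mem mult_mem)
lemma power_mem: "x \<in> K \<Longrightarrow> x ^ n \<in> K"
  by (induction n) (auto intro: one_mem mult_mem)

lemma ring_adjoin_subring: "complex_subring (ring_adjoin K a)"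
proof
  show "1 \<in> ring_adjoin K a"
    unfolding ring_adjoin_def
    by (rule CollectI, rule exI[of _ 1]) (auto simp: coeff_1 one_mem zero_mem)
  show "x - y \<in> ring_adjoin K a" "x * y \<in> ring_adjoin K a"
    if xy: "x \<in> ring_adjoin K a" "y \<in> ring_adjoin K a" for x y
  proof -
    obtain p q where p: "x = poly p a" "\<And>i. coeff p i \<in> K" and q: "y = poly q a" "\<And>i. coeff q i \<in> K"
      using xy by (auto simp: ring_adjoin_def)
    show "x - y \<in> ring_adjoin K a"
      unfolding ring_adjoin_def
      by (rule CollectI, rule exI[of _ "p - q"]) (auto simp: p q intro: diff_mem)
    show "x * y \<in> ring_adjoin K a"
      unfolding ring_adjoin_def
      by (rule CollectI, rule exI[of _ "p * q"]) (auto simp: p q coeff_mult intro!: sum_mem mult_mem)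
  qed
qed

lemma subset_ring_adjoin: "K \<subseteq> ring_adjoin K a"
proof
  fix x assume "x \<in> K"
  then show "x \<in> ring_adjoin K a"
    unfolding ring_adjoin_def
    by (intro CollectI exI[of _ "[:x:]"]) (auto simp: coeff_pCons zero_mem split: nat.splits)
qed

lemma mem_ring_adjoin: "a \<in> ring_adjoin K a"
  unfolding ring_adjoin_def
  by (intro CollectI exI[of _ "[:0, 1:]"]) (auto simp: coeff_pCons zero_mem one_mem split: nat.splits)

lemma subset_frac_set: "K \<subseteq> frac_set K"
  unfolding frac_set_def using one_mem by force

lemma frac_set_subring: "complex_subring (frac_set K)"
proof
  show "1 \<in> frac_set K" using subset_frac_set one_mem by blast
  show "x - y \<in> frac_set K" "x * y \<in> frac_set K" if xy: "x \<in> frac_set K" "y \<in> frac_set K" for x y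
  proof -
    obtain a b c d where *: "x = a / b" "y = c / d" "a \<in> K" "b \<in> K" "b \<noteq> 0" "c \<in> K" "d \<in> K" "d \<noteq> 0"
      using xy by (auto simp: frac_set_def)
    have "x - y = (a * d - c * b) / (b * d)" "x * y = (a * c) / (b * d)"
      using * by (auto simp: field_simps)
    moreover have "a * d - c * b \<in> K" "a * c \<in> K" "b * d \<in> K" "b * d \<noteq> 0"
      using * by (auto intro: diff_mem mult_mem)
    ultimately show "x - y \<in> frac_set K" "x * y \<in> frac_set K"
      unfolding frac_set_def by blast+
  qed
qed

lemma inverse_mem_frac_set:
  assumes "x \<in> frac_set K"
  shows "inverse x \<in> frac_set K"
proof -
  obtain a b where ab: "x = a / b" "a \<in> K" "b \<in> K" "b \<noteq> 0" using assms by (auto simp: frac_set_def)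
  show ?thesis
  proof (cases "a = 0")
    case True
    then show ?thesis using ab subset_frac_set zero_mem by auto
  next
    case False
    then show ?thesis using ab by (auto simp: frac_set_def)
  qed
qed

text \<open>The product of the individual denominators works. It turns relations over the fraction
  field into relations over \<open>K\<close>, to which \<open>lin_indep_over\<close>
  applies.\<close>

lemma common_denominator:
  assumes "finite B" "\<And>b. b \<in> B \<Longrightarrow> c b \<in> frac_set K"
  obtains d where "d \<in> K" "d \<noteq> 0" "\<And>b. b \<in> B \<Longrightarrow> d * c b \<in> K"
proof -
  have "\<forall>b\<in>B. \<exists>y. y \<in> K \<and> y \<noteq> 0 \<and> y * c b \<in> K"
    using assms(2) by (fastforce simp: frac_set_def)
  then obtain y where y: "\<And>b. b \<in> B \<Longrightarrow> y b \<in> K \<and> y b \<noteq> 0 \<and> y b * c b \<in> K" by metis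
  show thesis
  proof (rule that[of "prod y B"])
    fix b assume b: "b \<in> B"
    have "prod y B * c b = prod y (B - {b}) * (y b * c b)"
      using prod.remove[OF assms(1) b, of y] by simp
    moreover have "prod y (B - {b}) \<in> K" using y by (auto intro: prod_mem)
    ultimately show "prod y B * c b \<in> K" using y b by (simp only: mult_mem)
  qed (use y assms(1) in \<open>auto intro: prod_mem\<close>)
qed

end

section \<open>Linear algebra over subfields of the complex numbers\<close>

locale complex_subfield = complex_subring L for L +
  assumes inverse_mem: "x \<in> L \<Longrightarrow> inverse x \<in> L"
begin

lemma divide_mem: "x \<in> L \<Longrightarrow> y \<in> L \<Longrightarrow> x / y \<in> L"
  unfolding divide_inverse by (intro mult_mem inverse_mem)

lemma Rats_subset: "\<rat> \<subseteq> L"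
proof
  fix x :: complex assume "x \<in> \<rat>"
  then obtain m n :: int where x: "x = of_int m / of_int n"
    by (metis Rats_cases of_rat_rat quotient_of_div quotient_of_unique surj_pair Fract_of_int_quotient of_rat_of_int_eq of_rat_divide)
  have nat: "of_nat k \<in> L" for k by (induction k) (auto intro: zero_mem one_mem add_mem)
  have "of_int k \<in> L" for k
    using nat by (cases k rule: int_cases2) (auto intro: uminus_mem)
  then show "x \<in> L" unfolding x by (intro divide_mem)
qed

text \<open>Gaussian elimination by induction on the number of equations: the last one is either
  trivial or determines one unknown from the others.\<close>

lemma homogeneous_system_solvable:
  assumes "finite B" "card B > d" "\<And>i b. b \<in> B \<Longrightarrow> M i b \<in> L"
  shows "\<exists>c. (\<forall>b\<in>B. c b \<in> L) \<and> (\<exists>b\<in>B. c b \<noteq> 0) \<and> (\<forall>i<d. (\<Sum>b\<in>B. M i b * c b) = 0)"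
  using assms
proof (induction d arbitrary: B M)
  case 0
  then have "B \<noteq> {}" by auto
  then show ?case by (intro exI[of _ "\<lambda>_. 1"]) (auto intro: one_mem)
next
  case (Suc d)
  show ?case
  proof (cases "\<forall>b\<in>B. M d b = 0")
    case True
    obtain c where "\<forall>b\<in>B. c b \<in> L" "\<exists>b\<in>B. c b \<noteq> 0" "\<forall>i<d. (\<Sum>b\<in>B. M i b * c b) = 0"
      using Suc.IH[of B M] Suc.prems by auto
    then show ?thesis using True by (intro exI[of _ c]) (auto simp: less_Suc_eq)
  next
    case False
    then obtain b0 where b0: "b0 \<in> B" "M d b0 \<noteq> 0" by blast
    define B' where "B' = B - {b0}"
    \<comment> \<open>The system left after eliminating the unknown at \<open>b0\<close> by equation
      \<open>d\<close>; \<open>c'\<close> later restores that unknown so that equation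
      \<open>d\<close> holds.\<close>
    define M' where "M' = (\<lambda>i b. M i b - M i b0 * M d b / M d b0)"
    have "finite B'" "card B' > d" using Suc.prems b0 by (auto simp: B'_def)
    moreover have "M' i b \<in> L" if "b \<in> B'" for i b
      using that Suc.prems(3) b0 by (auto simp: M'_def B'_def intro!: diff_mem mult_mem divide_mem)
    ultimately obtain c where c: "\<And>b. b \<in> B' \<Longrightarrow> c b \<in> L" "\<exists>b\<in>B'. c b \<noteq> 0"
      "\<And>i. i < d \<Longrightarrow> (\<Sum>b\<in>B'. M' i b * c b) = 0"
      using Suc.IH[of B' M'] by blast
    define s where "s = (\<Sum>b\<in>B'. M d b * c b)"
    define c' where "c' = c(b0 := - s / M d b0)"
    have sL: "s \<in> L" unfolding s_def using Suc.prems(3) c by (auto simp: B'_def intro!: sum_mem mult_mem)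
    have c'B: "(\<Sum>b\<in>B. M i b * c' b) = (\<Sum>b\<in>B'. M i b * c b) - M i b0 * s / M d b0" for i
    proof -
      have "(\<Sum>b\<in>B. M i b * c' b) = M i b0 * c' b0 + (\<Sum>b\<in>B'. M i b * c' b)"
        unfolding B'_def by (rule sum.remove) (use Suc.prems b0 in auto)
      also have "(\<Sum>b\<in>B'. M i b * c' b) = (\<Sum>b\<in>B'. M i b * c b)"
        by (rule sum.cong) (auto simp: c'_def B'_def)
      finally show ?thesis by (simp add: c'_def)
    qed
    have M's: "(\<Sum>b\<in>B'. M' i b * c b) = (\<Sum>b\<in>B'. M i b * c b) - M i b0 * s / M d b0" for i
      by (simp add: M'_def s_def algebra_simps sum_subtractf sum_distrib_left sum_divide_distrib)
    show ?thesis
    proof (intro exI[of _ c'] conjI ballI allI impI)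
      show "c' b \<in> L" if "b \<in> B" for b
        using that c sL Suc.prems(3)[OF b0(1)] b0 by (auto simp: c'_def B'_def intro!: divide_mem uminus_mem)
      show "\<exists>b\<in>B. c' b \<noteq> 0" using c(2) by (auto simp: c'_def B'_def)
      show "(\<Sum>b\<in>B. M i b * c' b) = 0" if "i < Suc d" for i
      proof (cases "i = d")
        case True then show ?thesis using b0 by (simp add: c'B s_def)
      next
        case False then show ?thesis using that c(3)[of i] by (simp add: c'B M's)
      qed
    qed
  qed
qed

text \<open>As \<open>p\<close> rewrites \<open>a ^ degree p\<close> in lower powers, Horner's
  scheme never leaves their span. Only spanning is claimed, so \<open>p\<close> need not be a
  minimal polynomial.\<close>

lemma ring_adjoin_algebraic_basis:
  assumes p: "\<And>i. coeff p i \<in> L" "p \<noteq> 0" "poly p a = 0" and x: "x \<in> ring_adjoin L a"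
  shows "\<exists>c. (\<forall>i. c i \<in> L) \<and> x = (\<Sum>i<degree p. c i * a ^ i)"
proof -
  have "degree p \<noteq> 0" using p by (metis degree_eq_zeroE pCons_0_0 poly_pCons mult_zero_right add.right_neutral poly_0)
  then obtain m where m: "degree p = Suc m" using not0_implies_Suc by blast
  have lc: "lead_coeff p \<noteq> 0" using p by simp
  have top: "a ^ Suc m = (\<Sum>i\<le>m. (- coeff p i / lead_coeff p) * a ^ i)"
  proof -
    have "0 = (\<Sum>i\<le>m. coeff p i * a ^ i) + lead_coeff p * a ^ Suc m"
      using p(3) by (simp add: poly_altdef m)
    then have "a ^ Suc m = - (\<Sum>i\<le>m. coeff p i * a ^ i) / lead_coeff p"
      using lc by (simp add: field_simps eq_neg_iff_add_eq_0)
    then show ?thesis by (simp add: sum_negf sum_divide_distrib)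
  qed
  obtain q where q: "x = poly q a" "\<And>i. coeff q i \<in> L" using x by (auto simp: ring_adjoin_def)
  have "\<exists>c. (\<forall>i. c i \<in> L) \<and> poly q a = (\<Sum>i\<le>m. c i * a ^ i)"
    using q(2)
  proof (induction q)
    case 0
    then show ?case by (intro exI[of _ "\<lambda>_. 0"]) (auto intro: zero_mem)
  next
    case (pCons u q)
    have u: "u \<in> L" using pCons.prems[of 0] by simp
    have "coeff q i \<in> L" for i using pCons.prems[of "Suc i"] by simp
    then obtain c where c: "\<And>i. c i \<in> L" "poly q a = (\<Sum>i\<le>m. c i * a ^ i)" using pCons.IH by blast
    \<comment> \<open>Multiplication by \<open>a\<close> shifts the coefficients, \<open>u\<close>
      fills position 0, and the overflow \<open>c m * a ^ Suc m\<close> is reduced by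
      \<open>top\<close>.\<close>
    define c' where "c' = (\<lambda>i. (if i = 0 then u else c (i - 1)) - c m * coeff p i / lead_coeff p)"
    have "poly (pCons u q) a = u + (\<Sum>i\<le>m. c i * a ^ Suc i)"
      by (simp add: c sum_distrib_left mult_ac)
    also have "(\<Sum>i\<le>m. c i * a ^ Suc i) = (\<Sum>i<m. c i * a ^ Suc i) + c m * a ^ Suc m"
      by (simp flip: lessThan_Suc_atMost)
    also have "u + \<dots> = (\<Sum>i<Suc m. (if i = 0 then u else c (i - 1)) * a ^ i) + c m * a ^ Suc m"
      by (subst sum.lessThan_Suc_shift) simp
    also have "\<dots> = (\<Sum>i\<le>m. c' i * a ^ i)"
      unfolding top c'_def lessThan_Suc_atMost
      by (simp add: algebra_simps sum_distrib_left sum.distrib sum_subtractf sum_negf)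
    finally show ?case
      by (intro exI[of _ c']) (auto simp: c'_def intro!: c u p diff_mem mult_mem divide_mem)
  qed
  then show ?thesis by (simp add: q m lessThan_Suc_atMost)
qed

end

lemma (in complex_subring) frac_set_subfield: "complex_subfield (frac_set K)"
  by (intro complex_subfield.intro frac_set_subring complex_subfield_axioms.intro inverse_mem_frac_set)

text \<open>A nontrivial relation would let at most \<open>n\<close> powers of \<open>a\<close> span
  K[a] over the fraction field, making the n + 1 elements supplied by the degree condition dependent
  there; clearing denominators gives a dependence over \<open>K\<close>.\<close>

lemma (in complex_subring) powers_independent_if_ext_degree_ge:
  assumes deg: "ext_degree_ge K a (Suc n)"
    and c: "\<And>i. i \<le> n \<Longrightarrow> c i \<in> frac_set K" and eq: "(\<Sum>i\<le>n. c i * a ^ i) = 0" and "j \<le> n"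
  shows "c j = 0"
proof (rule ccontr)
  assume "c j \<noteq> 0"
  interpret L: complex_subfield "frac_set K" by (rule frac_set_subfield)
  define p where "p = (\<Sum>i\<le>n. monom (c i) i)"
  have coeff: "coeff p i = (if i \<le> n then c i else 0)" for i
    by (simp add: p_def coeff_sum if_distrib cong: if_cong)
  have "coeff p j \<noteq> 0" using \<open>c j \<noteq> 0\<close> \<open>j \<le> n\<close> by (simp add: coeff)
  then have "p \<noteq> 0" by auto
  moreover have "poly p a = 0" using eq by (simp add: p_def poly_sum poly_monom)
  ultimately have p: "coeff p i \<in> frac_set K" "p \<noteq> 0" "poly p a = 0" for i
    using c L.zero_mem by (auto simp: coeff)
  have degp: "degree p \<le> n" by (rule degree_le) (simp add: coeff)
  obtain B where B: "B \<subseteq> ring_adjoin K a" "finite B" "card B = Suc n" "lin_indep_over K B"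
    using deg by (auto simp: ext_degree_ge_def)
  have "B \<subseteq> ring_adjoin (frac_set K) a"
    using B(1) subset_frac_set unfolding ring_adjoin_def by blast
  then have "\<forall>b\<in>B. \<exists>m. (\<forall>i. m i \<in> frac_set K) \<and> b = (\<Sum>i<degree p. m i * a ^ i)"
    using L.ring_adjoin_algebraic_basis[OF p] by blast
  then obtain m where m: "\<And>b i. b \<in> B \<Longrightarrow> m b i \<in> frac_set K"
      "\<And>b. b \<in> B \<Longrightarrow> b = (\<Sum>i<degree p. m b i * a ^ i)" by metis
  obtain x where x: "\<And>b. b \<in> B \<Longrightarrow> x b \<in> frac_set K" "\<exists>b\<in>B. x b \<noteq> 0"
      "\<And>i. i < degree p \<Longrightarrow> (\<Sum>b\<in>B. m b i * x b) = 0"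
    using L.homogeneous_system_solvable[of B "degree p" "\<lambda>i b. m b i", OF B(2) _ m(1)] B(3) degp
    by (metis le_imp_less_Suc)
  obtain d where d: "d \<in> K" "d \<noteq> 0" "\<And>b. b \<in> B \<Longrightarrow> d * x b \<in> K"
    using common_denominator[of B x, OF B(2)] x(1) by blast
  have "(\<Sum>b\<in>B. d * x b * b) = (\<Sum>b\<in>B. \<Sum>i<degree p. d * a ^ i * (m b i * x b))"
    by (rule sum.cong[OF refl], subst (2) m(2)) (auto simp: sum_distrib_left algebra_simps)
  also have "\<dots> = (\<Sum>i<degree p. d * a ^ i * (\<Sum>b\<in>B. m b i * x b))"
    by (subst sum.swap) (simp add: sum_distrib_left)
  also have "\<dots> = 0" by (simp add: x)
  finally have "\<forall>b\<in>B. d * x b = 0"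
    using B(4) d(3) unfolding lin_indep_over_def by (auto dest!: spec[of _ "\<lambda>b. d * x b"])
  then show False using x(2) d(2) by auto
qed

section \<open>The rings and fields generated by the periods\<close>

lemma Qadj_subring: "complex_subring (Qadj \<omega> n)"
proof (induction n)
  case 0
  show ?case by unfold_locales auto
next
  case (Suc n)
  then show ?case by (simp add: complex_subring.ring_adjoin_subring)
qed

definition Qfrac :: "(nat \<Rightarrow> complex) \<Rightarrow> nat \<Rightarrow> complex set" where
  "Qfrac \<omega> n = frac_set (Qadj \<omega> n)"

lemma Qfrac_subfield: "complex_subfield (Qfrac \<omega> n)"
  unfolding Qfrac_def by (rule complex_subring.frac_set_subfield[OF Qadj_subring])

lemma Qfrac_mono: "Qfrac \<omega> n \<subseteq> Qfrac \<omega> (Suc n)"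
  using complex_subring.subset_ring_adjoin[OF Qadj_subring, of \<omega> n "\<omega> (Suc n)"]
  unfolding Qfrac_def frac_set_def by auto

lemma mem_Qfrac: "\<omega> (Suc n) \<in> Qfrac \<omega> (Suc n)"
  using complex_subring.mem_ring_adjoin[OF Qadj_subring, of "\<omega> (Suc n)" \<omega> n]
    complex_subring.subset_frac_set[OF Qadj_subring, of \<omega> "Suc n"]
  unfolding Qfrac_def by auto

section \<open>Difference equations for polynomials\<close>

text \<open>The recursion is \<open>sum_binomial_bernoulli_num\<close> solved for its last term. The
  resulting value -1/2 at 1 is the source of the factor in
  \<open>antidifference_coeff_1\<close>.\<close>

fun bernoulli_num :: "nat \<Rightarrow> complex" where
  "bernoulli_num n =
     (if n = 0 then 1 else - (\<Sum>i<n. of_nat (Suc n choose i) * bernoulli_num i) / of_nat (Suc n))"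

declare bernoulli_num.simps [simp del]

lemma bernoulli_num_0: "bernoulli_num 0 = 1"
  and bernoulli_num_1: "bernoulli_num (Suc 0) = - 1 / 2"
  by (simp_all add: bernoulli_num.simps)

lemma bernoulli_num_Rats: "bernoulli_num n \<in> \<rat>"
proof (induction n rule: less_induct)
  case (less n)
  then show ?case
    by (subst bernoulli_num.simps) (auto intro!: Rats_divide Rats_sum Rats_mult)
qed

lemma sum_binomial_bernoulli_num:
  "(\<Sum>i\<le>n. of_nat (Suc n choose i) * bernoulli_num i) = (if n = 0 then 1 else 0)"
proof (cases "n = 0")
  case False
  have "(\<Sum>i\<le>n. of_nat (Suc n choose i) * bernoulli_num i) =
      (\<Sum>i<n. of_nat (Suc n choose i) * bernoulli_num i) + of_nat (Suc n) * bernoulli_num n"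
    by (simp flip: lessThan_Suc_atMost)
  also have "\<dots> = 0"
    using False by (subst (2) bernoulli_num.simps) (simp del: of_nat_Suc)
  finally show ?thesis using False by simp
qed (simp add: bernoulli_num_0)

text \<open>The polynomial \<open>w ^ (j + 1) * B\<^sub>j\<^sub>+\<^sub>1(s / w) / (j + 1)\<close> without its constant term.\<close>
definition faulhaber_poly :: "complex \<Rightarrow> nat \<Rightarrow> complex poly" where
  "faulhaber_poly w j =
     (\<Sum>i\<le>j. monom (of_nat (Suc j choose i) * bernoulli_num i / of_nat (Suc j) * w ^ i) (Suc j - i))"

lemma sum_triangle_swap:
  fixes f :: "nat \<Rightarrow> nat \<Rightarrow> 'a::comm_monoid_add"
  shows "(\<Sum>i\<le>n. \<Sum>l\<le>n - i. f i l) = (\<Sum>l\<le>n. \<Sum>i\<le>n - l. f i l)"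
proof -
  have *: "(\<Sum>i\<le>n. \<Sum>l\<le>n - i. g i l) = (\<Sum>i\<le>n. \<Sum>l\<le>n. if i + l \<le> n then g i l else 0)"
    for g :: "nat \<Rightarrow> nat \<Rightarrow> 'a"
    by (intro sum.cong sum.mono_neutral_cong_left) auto
  show ?thesis
    unfolding * by (subst sum.swap) (simp add: add.commute)
qed

text \<open>Both sides are the trinomial coefficient n! / (i! l! (n - i - l)!).\<close>

lemma binomial_mult_swap:
  assumes "i + l \<le> n"
  shows "(n choose i) * ((n - i) choose l) = (n choose l) * ((n - l) choose i)"
proof -
  have "(n choose i) * ((n - i) choose l) = (n choose (i + l)) * ((i + l) choose i)"
    using choose_mult[of i "i + l" n] assms by simp
  also have "\<dots> = (n choose (i + l)) * ((i + l) choose l)"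
    using binomial_symmetric[of i "i + l"] by simp
  also have "\<dots> = (n choose l) * ((n - l) choose i)"
    using choose_mult[of l "i + l" n] assms by simp
  finally show ?thesis .
qed

lemma power_add_diff:
  fixes s w :: "'a::comm_ring_1"
  shows "(s + w) ^ Suc m - s ^ Suc m = (\<Sum>l\<le>m. of_nat (Suc m choose l) * s ^ l * w ^ (Suc m - l))"
  unfolding binomial_ring by simp

text \<open>Binomial expansion gives a double sum over i + l <= j. By the symmetry of trinomial
  coefficients it can be collected by powers of \<open>s\<close>; the inner sum over
  \<open>i\<close> is then the Bernoulli recursion and leaves only l = j.\<close>

lemma faulhaber_poly_difference:
  "poly (faulhaber_poly w j) (s + w) - poly (faulhaber_poly w j) s = w * s ^ j"
proof -
  have "of_nat (Suc j) * (poly (faulhaber_poly w j) (s + w) - poly (faulhaber_poly w j) s)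
      = (\<Sum>i\<le>j. of_nat (Suc j choose i) * bernoulli_num i * w ^ i * ((s + w) ^ (Suc j - i) - s ^ (Suc j - i)))"
    unfolding faulhaber_poly_def
    by (simp add: poly_sum poly_monom sum_distrib_left right_diff_distrib sum_subtractf del: of_nat_Suc binomial_Suc_Suc)
  also have "\<dots> = (\<Sum>i\<le>j. \<Sum>l\<le>j - i. of_nat (Suc j choose l) * s ^ l * w ^ (Suc j - l) *
      (of_nat (Suc (j - l) choose i) * bernoulli_num i))"
  proof (rule sum.cong[OF refl])
    fix i assume i: "i \<in> {..j}"
    have summand: "of_nat (Suc j choose i) * bernoulli_num i * w ^ i * (of_nat (Suc (j - i) choose l) * s ^ l * w ^ (Suc (j - i) - l))
      = of_nat (Suc j choose l) * s ^ l * w ^ (Suc j - l) * (of_nat (Suc (j - l) choose i) * bernoulli_num i)"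
      if "l \<le> j - i" for l
    proof -
      have il: "i + l \<le> Suc j" "i \<le> j" "l \<le> j" using that i by auto
      have "of_nat ((Suc j choose i) * (Suc (j - i) choose l)) = (of_nat ((Suc j choose l) * (Suc (j - l) choose i)) :: complex)"
        using binomial_mult_swap[OF il(1)] il by (simp only: Suc_diff_le)
      moreover have "w ^ i * w ^ (Suc (j - i) - l) = w ^ (Suc j - l)"
        using that i by (simp flip: power_add add: Suc_diff_le)
      moreover have "of_nat (Suc j choose i) * bernoulli_num i * w ^ i *
          (of_nat (Suc (j - i) choose l) * s ^ l * w ^ (Suc (j - i) - l)) =
        of_nat ((Suc j choose i) * (Suc (j - i) choose l)) * bernoulli_num i * s ^ l *
          (w ^ i * w ^ (Suc (j - i) - l))"
        by (simp only: of_nat_mult mult_ac)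
      ultimately show ?thesis by (simp only: of_nat_mult mult_ac)
    qed
    show "of_nat (Suc j choose i) * bernoulli_num i * w ^ i * ((s + w) ^ (Suc j - i) - s ^ (Suc j - i)) =
      (\<Sum>l\<le>j - i. of_nat (Suc j choose l) * s ^ l * w ^ (Suc j - l) * (of_nat (Suc (j - l) choose i) * bernoulli_num i))"
    proof -
      have "Suc j - i = Suc (j - i)" using i by (simp add: Suc_diff_le)
      then show ?thesis
        unfolding power_add_diff sum_distrib_left \<open>Suc j - i = Suc (j - i)\<close>
        by (intro sum.cong refl summand) simp
    qed
  qed
  also have "\<dots> = (\<Sum>l\<le>j. of_nat (Suc j choose l) * s ^ l * w ^ (Suc j - l) *
      (\<Sum>i\<le>j - l. of_nat (Suc (j - l) choose i) * bernoulli_num i))"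
    by (subst sum_triangle_swap) (simp only: sum_distrib_left)
  also have "\<dots> = (\<Sum>l\<le>j. if l = j then of_nat (Suc j) * s ^ j * w else 0)"
    unfolding sum_binomial_bernoulli_num by (intro sum.cong) (auto simp del: of_nat_Suc)
  also have "\<dots> = of_nat (Suc j) * (w * s ^ j)" by simp
  finally show ?thesis by (simp del: of_nat_Suc)
qed

text \<open>The factor \<open>inverse w\<close> cancels the \<open>w\<close> in
  \<open>faulhaber_poly_difference\<close>.\<close>

definition antidifference :: "complex \<Rightarrow> complex poly \<Rightarrow> complex poly" where
  "antidifference w R = smult (inverse w) (\<Sum>j\<le>degree R. smult (coeff R j) (faulhaber_poly w j))"

lemma antidifference_difference:
  assumes "w \<noteq> 0"
  shows "poly (antidifference w R) (s + w) - poly (antidifference w R) s = poly R s"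
proof -
  have cancel: "w * (inverse w * x) = x" for x using assms by (simp flip: mult.assoc)
  have "w * (poly (antidifference w R) (s + w) - poly (antidifference w R) s) =
    (\<Sum>j\<le>degree R. coeff R j * (poly (faulhaber_poly w j) (s + w) - poly (faulhaber_poly w j) s))"
    unfolding antidifference_def poly_smult poly_sum right_diff_distrib cancel sum_subtractf ..
  also have "\<dots> = w * poly R s"
    by (simp add: faulhaber_poly_difference poly_altdef[of R] sum_distrib_left mult_ac)
  finally show ?thesis using assms by simp
qed

lemma degree_antidifference: "degree (antidifference w R) \<le> Suc (degree R)"
proof -
  have "degree (faulhaber_poly w j) \<le> Suc j" for j
    unfolding faulhaber_poly_def
    by (intro degree_sum_le) (auto intro: order.trans[OF degree_monom_le])
  then have "degree (smult (coeff R j) (faulhaber_poly w j)) \<le> Suc (degree R)" if "j \<le> degree R" for j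
    using that by (meson degree_smult_le le_trans Suc_le_mono)
  then show ?thesis unfolding antidifference_def
    by (intro order.trans[OF degree_smult_le[of "inverse w"]] degree_sum_le) (simp_all del: degree_smult_eq)
qed

lemma (in complex_subfield) coeff_antidifference_mem:
  assumes "w \<in> L" "\<And>i. coeff R i \<in> L"
  shows "coeff (antidifference w R) i \<in> L"
proof -
  have "coeff (faulhaber_poly w j) i \<in> L" for j i
    unfolding faulhaber_poly_def coeff_sum coeff_monom
    using Rats_subset bernoulli_num_Rats
    by (intro sum_mem) (auto intro!: mult_mem power_mem divide_mem assms zero_mem
        simp del: of_nat_Suc binomial_Suc_Suc)
  then show ?thesis
    unfolding antidifference_def using assms
    by (auto simp: coeff_sum intro!: mult_mem sum_mem inverse_mem)
qed

text \<open>The coefficient of \<open>w ^ i\<close> in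
  \<open>w * poly (antidifference w R) x\<close>, with the coefficients of \<open>R\<close> regarded
  as constants. For \<open>i = 0\<close> it is the integral of \<open>R\<close> from 0 to
  \<open>x\<close>.\<close>

definition antidifference_coeff :: "complex poly \<Rightarrow> nat \<Rightarrow> complex \<Rightarrow> complex" where
  "antidifference_coeff R i x = (\<Sum>j=i..degree R.
     coeff R j * (of_nat (Suc j choose i) * bernoulli_num i / of_nat (Suc j)) * x ^ (Suc j - i))"

lemma poly_antidifference:
  assumes "w \<noteq> 0" "degree R \<le> n"
  shows "w * poly (antidifference w R) x = (\<Sum>i\<le>n. antidifference_coeff R i x * w ^ i)"
proof -
  define g where "g = (\<lambda>j i. coeff R j * (of_nat (Suc j choose i) * bernoulli_num i / of_nat (Suc j)) * x ^ (Suc j - i) * w ^ i)"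
  have cancel: "w * (inverse w * x) = x" for x using assms by (simp flip: mult.assoc)
  have "w * poly (antidifference w R) x = (\<Sum>j\<le>degree R. \<Sum>i\<le>j. g j i)"
    unfolding antidifference_def faulhaber_poly_def g_def poly_smult poly_sum poly_monom cancel
      sum_distrib_left
    by (intro sum.cong refl) (simp del: of_nat_Suc binomial_Suc_Suc)
  \<comment> \<open>Padding with zeros makes the inner range independent of \<open>j\<close>, so
    that the sums can be interchanged.\<close>
  also have "\<dots> = (\<Sum>j\<le>degree R. \<Sum>i\<le>n. if i \<le> j then g j i else 0)"
    using assms by (intro sum.cong sum.mono_neutral_cong_left) auto
  also have "\<dots> = (\<Sum>i\<le>n. \<Sum>j\<le>degree R. if i \<le> j then g j i else 0)" by (rule sum.swap)
  also have "\<dots> = (\<Sum>i\<le>n. \<Sum>j=i..degree R. g j i)"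
    by (intro sum.cong sum.mono_neutral_cong_right) auto
  finally show ?thesis
    by (simp add: antidifference_coeff_def g_def sum_distrib_right del: of_nat_Suc binomial_Suc_Suc)
qed

text \<open>For index 1 the binomial coefficient cancels \<open>Suc j\<close>. The sum starts at
  \<open>j = 1\<close> and so misses the constant term of \<open>R\<close>, which drops out of the
  difference.\<close>

lemma antidifference_coeff_1:
  "antidifference_coeff R 1 x - antidifference_coeff R 1 y = - (poly R x - poly R y) / 2"
proof -
  have "antidifference_coeff R 1 x = - (poly R x - coeff R 0) / 2" for x
  proof -
    have "antidifference_coeff R 1 x = (\<Sum>j=1..degree R. - 1 / 2 * (coeff R j * x ^ j))"
      unfolding antidifference_coeff_def
      by (intro sum.cong) (simp_all add: bernoulli_num_1 del: of_nat_Suc)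
    also have "\<dots> = - 1 / 2 * (\<Sum>j=1..degree R. coeff R j * x ^ j)"
      by (rule sum_distrib_left[symmetric])
    also have "(\<Sum>j=1..degree R. coeff R j * x ^ j) = poly R x - coeff R 0"
      unfolding poly_altdef by (simp add: atMost_atLeast0 sum.atLeast_Suc_atMost)
    finally show ?thesis by (simp only: mult_minus_left mult_minus_right divide_inverse mult_1 mult.commute)
  qed
  note * = this
  have "- (a - c) / 2 - - (b - c) / 2 = - (a - b) / 2" for a b c :: complex
    by (simp flip: diff_divide_distrib)
  then show ?thesis unfolding *[of x] *[of y] .
qed

lemma (in complex_subfield) antidifference_coeff_mem:
  assumes "x \<in> L" "\<And>i. coeff R i \<in> L"
  shows "antidifference_coeff R i x \<in> L"
  unfolding antidifference_coeff_def
  using Rats_subset bernoulli_num_Rats assms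
  by (auto intro!: sum_mem mult_mem power_mem divide_mem simp del: of_nat_Suc binomial_Suc_Suc)

text \<open>\<open>p - q\<close> has period \<open>w\<close> and a zero at \<open>a\<close>, hence
  infinitely many zeros.\<close>

lemma poly_eq_if_same_difference:
  fixes p q :: "complex poly"
  assumes w: "w \<noteq> 0" and "\<And>s. poly p (s + w) - poly p s = poly q (s + w) - poly q s" and "poly p a = poly q a"
  shows "p = q"
proof -
  have "poly (p - q) (a + of_nat n * w) = 0" for n
  proof (induction n)
    case (Suc n)
    have "a + of_nat (Suc n) * w = (a + of_nat n * w) + w" by (simp add: algebra_simps)
    then show ?case using Suc assms(2)[of "a + of_nat n * w"] by (simp only: poly_diff) simp
  qed (use assms in simp)
  then have "range (\<lambda>n. a + of_nat n * w) \<subseteq> {x. poly (p - q) x = 0}" by auto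
  moreover have "infinite (range (\<lambda>n. a + of_nat n * w))"
    using w by (intro range_inj_infinite injI) simp
  ultimately show ?thesis
    using poly_roots_finite[of "p - q"] finite_subset by (metis right_minus_eq)
qed

lemma difference_hierarchy_trivial:
  fixes q :: "nat \<Rightarrow> complex poly" and k :: "nat \<Rightarrow> int"
  assumes w: "\<And>n. \<omega> (Suc n) \<noteq> 0"
    and deg: "\<And>n. n < N \<Longrightarrow> ext_degree_ge (Qadj \<omega> n) (\<omega> (Suc n)) (Suc (Suc n))"
    and q0: "q 0 = 0" and q1: "\<And>n. poly (q n) 1 = 0"
    and diff: "\<And>n s. poly (q (Suc n)) (s + \<omega> (Suc n)) - poly (q (Suc n)) s = of_int (k n) - poly (q n) s"
    and r: "r \<in> \<rat>" "r \<noteq> 1" and int: "poly (q N) r \<in> \<int>" and "n \<le> N"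
  shows "q n = 0"
proof -
  define R where "R = (\<lambda>n. [:of_int (k n):] - q n)"
  have q_Suc: "q (Suc n) = antidifference (\<omega> (Suc n)) (R n) - [:poly (antidifference (\<omega> (Suc n)) (R n)) 1:]" for n
    by (rule poly_eq_if_same_difference[OF w[of n], of _ _ 1])
      (simp_all add: diff antidifference_difference[OF w] q1 R_def)
  have coeffR: "coeff (R n) i \<in> Qfrac \<omega> n" if "\<And>i. coeff (q n) i \<in> Qfrac \<omega> n" for n i
  proof -
    interpret complex_subfield "Qfrac \<omega> n" by (rule Qfrac_subfield)
    show ?thesis using Rats_subset that
      by (auto simp: R_def coeff_pCons split: nat.split intro!: diff_mem uminus_mem)
  qed
  \<comment> \<open>Together with \<open>coeffR\<close> this puts the coefficients of
    \<open>R n\<close> in the field of level \<open>n\<close>, so that the expansion in powers of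
    \<open>\<omega> (Suc n)\<close> has its coefficients in the smaller field.\<close>
  have mem: "coeff (q n) i \<in> Qfrac \<omega> n" for n i
  proof (induction n arbitrary: i)
    case 0
    then show ?case using complex_subfield.Rats_subset[OF Qfrac_subfield, of \<omega> 0] by (auto simp: q0)
  next
    case (Suc n)
    interpret complex_subfield "Qfrac \<omega> (Suc n)" by (rule Qfrac_subfield)
    have "coeff (R n) i \<in> Qfrac \<omega> (Suc n)" for i
      using coeffR[OF Suc] Qfrac_mono by blast
    then have anti: "coeff (antidifference (\<omega> (Suc n)) (R n)) i \<in> Qfrac \<omega> (Suc n)" for i
      by (intro coeff_antidifference_mem mem_Qfrac)
    then have "poly (antidifference (\<omega> (Suc n)) (R n)) 1 \<in> Qfrac \<omega> (Suc n)"
      by (auto simp: poly_altdef intro!: sum_mem)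
    then show ?case unfolding q_Suc
      using anti by (auto simp: coeff_pCons zero_mem split: nat.split intro!: diff_mem)
  qed
  have degR: "degree (R n) \<le> n" if "degree (q n) \<le> n" for n
    unfolding R_def using that by (intro degree_diff_le) auto
  have degq: "degree (q n) \<le> n" for n
  proof (induction n)
    case (Suc n)
    show ?case unfolding q_Suc
      using degree_antidifference[of "\<omega> (Suc n)" "R n"] degR[OF Suc]
      by (intro degree_diff_le) auto
  qed (simp add: q0)
  show ?thesis
    using deg int \<open>n \<le> N\<close>
  proof (induction N arbitrary: n)
    case 0
    then show ?case by (simp add: q0)
  next
    case (Suc N)
    interpret K: complex_subring "Qadj \<omega> N" by (rule Qadj_subring)
    interpret L: complex_subfield "Qfrac \<omega> N" by (rule Qfrac_subfield)
    obtain m where m: "poly (q (Suc N)) r = of_int m" using Suc.prems(2) by (auto elim: Ints_cases)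
    define e where "e = (\<lambda>i. antidifference_coeff (R N) i r - antidifference_coeff (R N) i 1)"
    \<comment> \<open>Subtracting \<open>m\<close> in degree one encodes \<open>\<omega> (Suc N) *
      poly (q (Suc N)) r = of_int m * \<omega> (Suc N)\<close> as a linear relation between
      powers.\<close>
    define c where "c = (\<lambda>i. e i - (if i = 1 then of_int m else 0))"
    have rL: "r \<in> Qfrac \<omega> N" and mL: "of_int m \<in> Qfrac \<omega> N" using r L.Rats_subset by auto
    have cL: "c i \<in> frac_set (Qadj \<omega> N)" for i
      using L.diff_mem L.antidifference_coeff_mem[OF rL coeffR[OF mem]]
        L.antidifference_coeff_mem[OF L.one_mem coeffR[OF mem]] mL L.zero_mem
      unfolding c_def e_def Qfrac_def by auto
    have "(\<Sum>i\<le>Suc N. c i * \<omega> (Suc N) ^ i) = (\<Sum>i\<le>Suc N. e i * \<omega> (Suc N) ^ i)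
        - (\<Sum>i\<le>Suc N. if i = 1 then of_int m * \<omega> (Suc N) else 0)"
      unfolding c_def by (subst sum_subtractf[symmetric], intro sum.cong) (auto simp: algebra_simps)
    \<comment> \<open>The range ends at \<open>Suc N\<close>, not at the degree bound
      \<open>N\<close>, so that the linear coefficient is present even for
      \<open>N = 0\<close>.\<close>
    also have "(\<Sum>i\<le>Suc N. e i * \<omega> (Suc N) ^ i) = \<omega> (Suc N) * poly (q (Suc N)) r"
      using poly_antidifference[OF w, of "R N" "Suc N" N] le_SucI[OF degR[OF degq[of N]]]
      unfolding e_def q_Suc by (simp add: left_diff_distrib sum_subtractf right_diff_distrib del: sum.atMost_Suc)
    finally have "(\<Sum>i\<le>Suc N. c i * \<omega> (Suc N) ^ i) = 0" by (simp add: m)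
    then have c0: "c i = 0" if "i \<le> Suc N" for i
      using K.powers_independent_if_ext_degree_ge[OF Suc.prems(1)[of N], of c i] cL that by simp
    have "- (poly (R N) r - poly (R N) 1) / 2 = of_int m"
      using c0[of 1] antidifference_coeff_1[of "R N" r 1] by (simp add: c_def e_def)
    then have "poly (q N) r = of_int (2 * m)" by (simp add: R_def q1)
    \<comment> \<open>Integrality at \<open>r\<close> passes down one level, so the induction
      hypothesis applies.\<close>
    then have "poly (q N) r \<in> \<int>" by (metis Ints_of_int)
    then have IH: "q n = 0" if "n \<le> N" for n
      using Suc.IH Suc.prems(1) that by simp
    have RN: "R N = [:of_int (k N):]" using IH[of N] by (simp add: R_def)
    have "e 0 = of_int (k N) * (r - 1)"
      by (simp add: e_def antidifference_coeff_def RN bernoulli_num_0 algebra_simps)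
    then have "R N = 0" using c0[of 0] r by (simp add: c_def RN)
    then have "q (Suc N) = 0" by (simp add: q_Suc antidifference_def)
    then show ?case using IH Suc.prems(3) by (cases "n = Suc N") auto
  qed
qed

section \<open>Quotients of two hierarchies\<close>

lemma open_halfspace: "open {s. Re s > 0}"
  and convex_halfspace: "convex {s. Re s > 0}"
  using open_halfspace_Re_gt[of 0] convex_halfspace_Re_gt[of 0] by simp_all

text \<open>Every point of \<open>S\<close> is a limit of points of equality. This makes the
  hierarchy's identities, given off a sparse set, pointwise wherever \<open>LLD\<close> supplies
  continuity.\<close>

lemma continuous_eq_if_cosparse_eq:
  fixes u v :: "complex \<Rightarrow> complex"
  assumes "open S" "continuous_on S u" "continuous_on S v"
    and eq: "\<forall>\<^sub>\<approx>s. s \<in> S \<longrightarrow> u s = v s" and x: "x \<in> S"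
  shows "u x = v x"
proof -
  have "isCont u x" "isCont v x"
    using assms continuous_on_eq_continuous_at by blast+
  then have lim: "(u \<longlongrightarrow> u x) (at x)" "(v \<longlongrightarrow> v x) (at x)" by (simp_all add: isCont_def)
  have "eventually (\<lambda>s. s \<in> S) (at x)" using assms(1) x by (rule eventually_at_in_open')
  moreover have "eventually (\<lambda>s. s \<in> S \<longrightarrow> u s = v s) (at x)"
    using eventually_cosparse_imp_eventually_at[OF eq] by simp
  ultimately have "eventually (\<lambda>s. u s = v s) (at x)" by eventually_elim auto
  then have "(v \<longlongrightarrow> u x) (at x)" using lim(1) by (rule Lim_transform_eventually[rotated])
  then show ?thesis using lim(2) tendsto_unique by (metis at_neq_bot)
qed

lemma entire_nonzero_cosparse:
  assumes h: "h holomorphic_on UNIV" and "h z \<noteq> (0::complex)"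
  shows "\<forall>\<^sub>\<approx>s. h s \<noteq> 0"
proof -
  have "h meromorphic_on UNIV"
    using h by (intro analytic_on_imp_meromorphic_on) (simp add: analytic_on_open)
  then have "(\<forall>\<^sub>\<approx>s. h s = 0) \<or> (\<forall>\<^sub>\<approx>s. h s \<noteq> 0)"
    by (rule meromorphic_imp_constant_or_avoid) auto
  moreover have False if "\<forall>\<^sub>\<approx>s. h s = 0"
    using continuous_eq_if_cosparse_eq[of UNIV h "\<lambda>_. 0" z] that assms
    by (simp add: holomorphic_on_imp_continuous_on)
  ultimately show ?thesis by blast
qed

text \<open>Off a sparse set, the meromorphic function \<open>f - g\<close> is either zero or
  nonzero throughout; its vanishing near 1 excludes the latter.\<close>

lemma meromorphic_eq_if_eq_halfspace:
  assumes "f meromorphic_on UNIV" "g meromorphic_on UNIV" and eq: "\<And>s. Re s > 0 \<Longrightarrow> f s = g s"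
  shows "\<forall>\<^sub>\<approx>s. f s = g s"
proof -
  have "(\<lambda>s. f s - g s) meromorphic_on UNIV" using assms by (intro meromorphic_intros)
  then have "(\<forall>\<^sub>\<approx>s. f s - g s = 0) \<or> (\<forall>\<^sub>\<approx>s. f s - g s \<noteq> 0)"
    by (rule meromorphic_imp_constant_or_avoid) auto
  moreover have False if "\<forall>\<^sub>\<approx>s. f s - g s \<noteq> 0"
  proof -
    have "eventually (\<lambda>s. f s - g s \<noteq> 0) (at 1)"
      using eventually_cosparse_imp_eventually_at[OF that] by simp
    moreover have "eventually (\<lambda>s. s \<in> {s. Re s > 0}) (at 1)"
      by (rule eventually_at_in_open'[OF open_halfspace]) simp
    ultimately have "eventually (\<lambda>s::complex. False) (at 1)"
      by eventually_elim (use eq in auto)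
    then show False by simp
  qed
  ultimately show ?thesis by auto
qed

text \<open>The values are integer multiples of 2 pi i, and distinct ones lie at least 2 pi
  apart.\<close>

lemma exp_eq_1_continuous_constant:
  fixes D :: "complex \<Rightarrow> complex"
  assumes S: "connected S" and cont: "continuous_on S D" and one: "\<And>s. s \<in> S \<Longrightarrow> exp (D s) = 1"
  obtains k :: int where "\<And>s. s \<in> S \<Longrightarrow> D s = 2 * pi * \<i> * k"
proof -
  have val: "\<exists>k::int. D s = 2 * pi * \<i> * k" if "s \<in> S" for s
  proof -
    have "Re (D s) = 0 \<and> (\<exists>n::int. Im (D s) = of_int (2 * n) * pi)"
      using one[OF that] by (simp only: exp_eq_1)
    then obtain n :: int where "Re (D s) = 0" "Im (D s) = of_int (2 * n) * pi" by blast
    then show ?thesis by (intro exI[of _ n]) (simp add: complex_eq_iff)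
  qed
  have "D constant_on S"
  proof (rule continuous_discrete_range_constant[OF S cont])
    fix x assume x: "x \<in> S"
    show "\<exists>e>0. \<forall>y. y \<in> S \<and> D y \<noteq> D x \<longrightarrow> e \<le> norm (D y - D x)"
    proof (intro exI[of _ "2 * pi"] conjI allI impI)
      fix y assume y: "y \<in> S \<and> D y \<noteq> D x"
      obtain k l :: int where kl: "D x = 2 * pi * \<i> * k" "D y = 2 * pi * \<i> * l"
        using val x y by blast
      then have "l \<noteq> k" using y by auto
      then have "1 \<le> \<bar>real_of_int (l - k)\<bar>" by linarith
      moreover have "D y - D x = 2 * pi * \<i> * of_int (l - k)" by (simp add: kl algebra_simps)
      then have "norm (D y - D x) = 2 * pi * \<bar>real_of_int (l - k)\<bar>"
        by (simp only: norm_mult norm_of_int) simp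
      ultimately show "2 * pi \<le> norm (D y - D x)" by (simp add: mult_left_mono)
    qed simp
  qed
  then show thesis
    using val that by (cases "S = {}") (auto simp: constant_on_def, metis)
qed

text \<open>Adding enough periods moves any point into the half-plane, and by periodicity the value
  found there does not depend on how many are added.\<close>

lemma periodic_halfspace_extend:
  assumes G: "G holomorphic_on {s. Re s > 0}" and w: "Re w > 0"
    and per: "\<And>s. Re s > 0 \<Longrightarrow> G (s + w) = G s"
  obtains F where "F holomorphic_on UNIV" "\<And>s. Re s > 0 \<Longrightarrow> F s = G s" "\<And>s. F (s + w) = F s"
proof -
  have ex: "\<exists>n. Re (s + of_nat n * w) > 0" for s
  proof -
    obtain n where "- Re s < of_nat n * Re w" using w reals_Archimedean3 by blast
    then show ?thesis by (intro exI[of _ n]) simp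
  qed
  have mult: "G (s + of_nat n * w) = G s" if "Re s > 0" for s n
  proof (induction n)
    case (Suc n)
    have "Re (s + of_nat n * w) > 0" using that w by (simp add: add_pos_nonneg)
    then have "G (s + of_nat n * w + w) = G (s + of_nat n * w)" by (rule per)
    then show ?case using Suc by (simp add: algebra_simps)
  qed simp
  have indep: "G (s + of_nat m * w) = G (s + of_nat n * w)"
    if "Re (s + of_nat m * w) > 0" "m \<le> n" for s m n
    using mult[OF that(1), of "n - m"] that(2) by (simp add: of_nat_diff algebra_simps)
  define F where "F = (\<lambda>s. G (s + of_nat (SOME n. Re (s + of_nat n * w) > 0) * w))"
  have F: "F s = G (s + of_nat n * w)" if "Re (s + of_nat n * w) > 0" for s n
    using someI_ex[OF ex[of s]] indep that unfolding F_def by (metis nle_le)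
  show thesis
  proof
    have "F holomorphic_on (\<Union>n. {s. Re (s + of_nat n * w) > 0})"
    proof (rule holomorphic_on_UN_open)
      fix n :: nat
      have eq: "{s. Re (s + of_nat n * w) > 0} = {s. Re s > - (real n * Re w)}" by auto
      show "open {s. Re (s + of_nat n * w) > 0}" unfolding eq by (rule open_halfspace_Re_gt)
      have "(G \<circ> (\<lambda>s. s + of_nat n * w)) holomorphic_on {s. Re (s + of_nat n * w) > 0}"
        by (rule holomorphic_on_compose_gen[OF _ G]) (auto intro!: holomorphic_intros)
      then show "F holomorphic_on {s. Re (s + of_nat n * w) > 0}"
        by (rule holomorphic_transform) (use F in auto)
    qed
    moreover have "(\<Union>n. {s. Re (s + of_nat n * w) > 0}) = UNIV" using ex by auto
    ultimately show "F holomorphic_on UNIV" by simp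
    show "F s = G s" if "Re s > 0" for s using F[of s 0] that by simp
    show "F (s + w) = F s" for s
    proof -
      obtain n where n: "Re (s + of_nat n * w) > 0" using ex by blast
      then have "F (s + w) = G (s + w + of_nat n * w)" using w by (intro F) simp
      also have "\<dots> = G (s + of_nat n * w)" using per[OF n] by (simp add: algebra_simps)
      finally show ?thesis using F[OF n] by simp
    qed
  qed
qed

text \<open>Clearing denominators gives an identity of entire functions, valid first on the
  half-plane off a sparse set, then everywhere by continuity and analytic continuation.\<close>

lemma exp_factor_finite_order_imp_poly:
  assumes g: "mero_finite_order g" and g': "mero_finite_order g'" "LLD g'"
    and F: "F holomorphic_on UNIV" and eq: "\<And>s. Re s > 0 \<Longrightarrow> g s = exp (F s) * g' s"
  obtains p where "\<And>s. F s = poly p s"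
proof -
  obtain h1 h2 z where h: "entire_finite_order h1" "entire_finite_order h2" "h2 z \<noteq> 0"
      "\<forall>\<^sub>\<approx>s. g s = h1 s / h2 s"
    using g by (auto simp: mero_finite_order_def)
  obtain h1' h2' z' where h': "entire_finite_order h1'" "entire_finite_order h2'" "h2' z' \<noteq> 0"
      "\<forall>\<^sub>\<approx>s. g' s = h1' s / h2' s"
    using g' by (auto simp: mero_finite_order_def)
  have hol: "h1 holomorphic_on UNIV" "h2 holomorphic_on UNIV" "h1' holomorphic_on UNIV" "h2' holomorphic_on UNIV"
    using h h' by (auto simp: entire_finite_order_def)
  note nz = entire_nonzero_cosparse[of h2, OF hol(2) h(3)] entire_nonzero_cosparse[of h2', OF hol(4) h'(3)]
  define A B where "A = (\<lambda>s. h1' s * h2 s)" and "B = (\<lambda>s. h1 s * h2' s)"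
  have holA: "(\<lambda>s. exp (F s) * A s) holomorphic_on UNIV" and holB: "B holomorphic_on UNIV"
    unfolding A_def B_def by (intro holomorphic_intros F hol)+
  have cosparse: "\<forall>\<^sub>\<approx>s. s \<in> {s. Re s > 0} \<longrightarrow> exp (F s) * A s = B s \<and> A s \<noteq> 0"
    using nz h(4) h'(4)
  proof eventually_elim
    case (elim s)
    show ?case
    proof
      assume s: "s \<in> {s. Re s > 0}"
      then have "h1 s / h2 s = exp (F s) * (h1' s / h2' s)" using eq elim by simp
      \<comment> \<open>This ensures that \<open>A\<close> is not identically zero: a zero of
        \<open>h1'\<close> here would be a zero of \<open>g'\<close>.\<close>
      moreover have "g' s \<noteq> 0" using s g'(2) by (simp add: LLD_def)
      then have "h1' s \<noteq> 0" using elim by auto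
      ultimately show "exp (F s) * A s = B s \<and> A s \<noteq> 0"
        using elim by (simp add: A_def B_def field_simps)
    qed
  qed
  have "eventually (\<lambda>s. s \<in> {s. Re s > 0}) (at 1)"
    by (rule eventually_at_in_open'[OF open_halfspace]) simp
  moreover have "eventually (\<lambda>s. s \<in> {s. Re s > 0} \<longrightarrow> exp (F s) * A s = B s \<and> A s \<noteq> 0) (at 1)"
    using eventually_cosparse_imp_eventually_at[OF cosparse] by simp
  ultimately have "eventually (\<lambda>s. A s \<noteq> 0) (at (1::complex))" by eventually_elim auto
  then obtain c where c: "A c \<noteq> 0" using eventually_happens'[OF at_neq_bot] by blast
  have half: "exp (F s) * A s = B s" if "s \<in> {s. Re s > 0}" for s
  proof (rule continuous_eq_if_cosparse_eq[OF open_halfspace _ _ _ that, of "\<lambda>s. exp (F s) * A s" B])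
    show "continuous_on {s. Re s > 0} (\<lambda>s. exp (F s) * A s)" "continuous_on {s. Re s > 0} B"
      using holA holB by (meson continuous_on_subset holomorphic_on_imp_continuous_on subset_UNIV)+
    show "\<forall>\<^sub>\<approx>s. s \<in> {s. Re s > 0} \<longrightarrow> exp (F s) * A s = B s"
      using cosparse by eventually_elim simp
  qed
  have "exp (F s) * A s = B s" for s
    by (rule analytic_continuation_open[OF open_halfspace open_UNIV _ _ _ holA holB])
      (use half in \<open>auto simp: set_eq_iff intro: exI[of _ 1]\<close>)
  moreover have "entire_finite_order A" "entire_finite_order B"
    unfolding A_def B_def using h h' by (blast intro: entire_finite_order_mult)+
  ultimately show thesis
    using exp_quotient_finite_order_imp_poly[of A c B F] c F that by blast
qed

text \<open>One level of the comparison, with \<open>u\<close> and \<open>u'\<close> the functions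
  one level below. The integer \<open>k\<close> records the ambiguity of the logarithm, constant
  because the half-plane is connected.\<close>

lemma gamma_quotient_step:
  fixes g g' u u' :: "complex \<Rightarrow> complex"
  assumes w: "Re w > 0" and g: "LLD g" "mero_finite_order g" and g': "LLD g'" "mero_finite_order g'"
    and u: "LLD u" "LLD u'" "\<And>s. Re s > 0 \<Longrightarrow> u s = exp (poly P s) * u' s"
    and rec: "\<forall>\<^sub>\<approx>s. g (s + w) = inverse (u s) * g s" "\<forall>\<^sub>\<approx>s. g' (s + w) = inverse (u' s) * g' s"
  obtains p and k :: int where "\<And>s. Re s > 0 \<Longrightarrow> g s = exp (poly p s) * g' s"
    "\<And>s. poly p (s + w) - poly p s = 2 * pi * \<i> * k - poly P s"
proof -
  have w0: "w \<noteq> 0" using w by auto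
  let ?H = "{s. Re s > 0}"
  have nz: "g s \<noteq> 0" "g' s \<noteq> 0" "u s \<noteq> 0" "u' s \<noteq> 0" if "Re s > 0" for s
    using that g g' u by (auto simp: LLD_def)
  have shift: "(\<lambda>s. f (s + w)) holomorphic_on ?H" if "f holomorphic_on ?H" for f
  proof -
    have "(\<lambda>s. s + w) ` ?H \<subseteq> ?H" using w by auto
    then show ?thesis
      using holomorphic_on_compose_gen[of "\<lambda>s. s + w" ?H f ?H, OF _ that]
      by (simp add: o_def holomorphic_intros)
  qed
  have rec': "f (s + w) = inverse (v s) * f s"
    if f: "LLD f" "LLD v" "\<forall>\<^sub>\<approx>s. f (s + w) = inverse (v s) * f s" and s: "Re s > 0" for f v s
  proof (rule continuous_eq_if_cosparse_eq[OF open_halfspace, of "\<lambda>s. f (s + w)" "\<lambda>s. inverse (v s) * f s"])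
    show "continuous_on ?H (\<lambda>s. f (s + w))"
      using f shift by (auto simp: LLD_def intro: holomorphic_on_imp_continuous_on)
    show "continuous_on ?H (\<lambda>s. inverse (v s) * f s)"
      using f by (auto simp: LLD_def intro!: holomorphic_on_imp_continuous_on holomorphic_intros)
  qed (use f s in \<open>auto elim: eventually_mono\<close>)
  have "(\<lambda>s. g s / g' s) holomorphic_on ?H"
    using g g' by (intro holomorphic_intros) (auto simp: LLD_def)
  then obtain H where H: "H holomorphic_on ?H" "\<And>s. s \<in> ?H \<Longrightarrow> exp (H s) = g s / g' s"
    by (rule holomorphic_logarithm_exists[OF convex_halfspace open_halfspace, of _ 1]) (auto simp: nz)
  \<comment> \<open>Dividing the two recursions gives exp (H (s + w) - H s) = exp (- P s), hence exp
    (D s) = 1.\<close>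
  define D where "D = (\<lambda>s. H (s + w) - H s + poly P s)"
  have "exp (D s) = 1" if s: "s \<in> ?H" for s
  proof -
    have s': "Re s > 0" "s + w \<in> ?H" using s w by auto
    have "exp (D s) = (g (s + w) / g' (s + w)) / (g s / g' s) * exp (poly P s)"
      using H(2)[OF s] H(2)[OF s'(2)] by (simp add: D_def exp_add exp_diff)
    also have "\<dots> = 1"
      using nz[OF s'(1)]
      unfolding rec'[OF g(1) u(1) rec(1) s'(1)] rec'[OF g'(1) u(2) rec(2) s'(1)] u(3)[OF s'(1)]
      by (simp add: field_simps)
    finally show ?thesis .
  qed
  moreover have "continuous_on ?H D"
    unfolding D_def using H(1) shift
    by (intro holomorphic_on_imp_continuous_on holomorphic_intros) auto
  ultimately obtain k :: int where k: "\<And>s. s \<in> ?H \<Longrightarrow> D s = 2 * pi * \<i> * k"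
    using exp_eq_1_continuous_constant[OF convex_connected[OF convex_halfspace]] by blast
  \<comment> \<open>A polynomial solution of the difference equation that \<open>H\<close>
    satisfies, so \<open>H - Q\<close> is periodic.\<close>
  define Q where "Q = antidifference w ([:2 * pi * \<i> * k:] - P)"
  have Q: "poly Q (s + w) - poly Q s = 2 * pi * \<i> * k - poly P s" for s
    unfolding Q_def by (subst antidifference_difference[OF w0]) simp
  obtain F where F: "F holomorphic_on UNIV" "\<And>s. Re s > 0 \<Longrightarrow> F s = H s - poly Q s" "\<And>s. F (s + w) = F s"
  proof (rule periodic_halfspace_extend[of "\<lambda>s. H s - poly Q s" w])
    show "(\<lambda>s. H s - poly Q s) holomorphic_on ?H" using H by (intro holomorphic_intros)
    show "H (s + w) - poly Q (s + w) = H s - poly Q s" if "Re s > 0" for s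
    proof -
      have "H (s + w) - H s = poly Q (s + w) - poly Q s"
        using k[of s] that unfolding Q D_def by (simp add: eq_diff_eq)
      then show ?thesis by (simp add: algebra_simps)
    qed
  qed (use w in auto)
  obtain p where p: "\<And>s. F s + poly Q s = poly p s"
  proof (rule exp_factor_finite_order_imp_poly[OF g(2) g'(2,1)])
    show "(\<lambda>s. F s + poly Q s) holomorphic_on UNIV" using F by (intro holomorphic_intros)
    show "g s = exp (F s + poly Q s) * g' s" if "Re s > 0" for s
      using F(2)[OF that] H(2)[of s] nz[OF that] that by simp
  qed blast
  show thesis
  proof
    show "g s = exp (poly p s) * g' s" if "Re s > 0" for s
      using F(2)[OF that] H(2)[of s] nz[OF that] that by (simp flip: p)
    show "poly p (s + w) - poly p s = 2 * pi * \<i> * k - poly P s" for s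
      using Q[of s] F(3)[of s] by (simp flip: p)
  qed
qed

lemma gamma_hierarchy_quotient:
  assumes \<omega>: "\<And>n. Re (\<omega> (Suc n)) > 0" and g: "gamma_hierarchy f \<omega> g" and g': "gamma_hierarchy f \<omega> g'"
  obtains q :: "nat \<Rightarrow> complex poly" and k :: "nat \<Rightarrow> int" where
    "q 0 = 0" "\<And>n. poly (q n) 1 = 0"
    "\<And>n s. Re s > 0 \<Longrightarrow> g n s = exp (2 * pi * \<i> * poly (q n) s) * g' n s"
    "\<And>n s. poly (q (Suc n)) (s + \<omega> (Suc n)) - poly (q (Suc n)) s = of_int (k n) - poly (q n) s"
proof -
  have LLD: "LLD (g n)" "LLD (g' n)" and fin: "mero_finite_order (g n)" "mero_finite_order (g' n)" for n
    using g g' by (auto simp: gamma_hierarchy_def)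
  define \<Phi> where "\<Phi> = (\<lambda>n p. (n = 0 \<longrightarrow> p = 0) \<and> poly p 1 = 0 \<and>
    (\<forall>s. Re s > 0 \<longrightarrow> g n s = exp (2 * pi * \<i> * poly p s) * g' n s))"
  define \<Psi> where "\<Psi> = (\<lambda>n p p'. \<exists>k::int. \<forall>s. poly p' (s + \<omega> (Suc n)) - poly p' s = of_int k - poly p s)"
  have "\<exists>q. \<forall>n. \<Phi> n (q n) \<and> \<Psi> n (q n) (q (Suc n))"
  proof (rule dependent_nat_choice)
    have ev: "\<forall>\<^sub>\<approx>s. g 0 s = inverse (f s)" "\<forall>\<^sub>\<approx>s. g' 0 s = inverse (f s)"
      using g g' by (auto simp: gamma_hierarchy_def)
    then have "\<forall>\<^sub>\<approx>s. s \<in> {s. Re s > 0} \<longrightarrow> g 0 s = g' 0 s" by eventually_elim simp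
    then have "g 0 s = g' 0 s" if "Re s > 0" for s
      using continuous_eq_if_cosparse_eq[OF open_halfspace, of "g 0" "g' 0" s] LLD[of 0] that
      by (auto simp: LLD_def holomorphic_on_imp_continuous_on)
    then show "\<exists>p. \<Phi> 0 p" by (intro exI[of _ 0]) (auto simp: \<Phi>_def)
  next
    fix P n assume P: "\<Phi> n P"
    have rec: "\<forall>\<^sub>\<approx>s. g (Suc n) (s + \<omega> (Suc n)) = inverse (g n s) * g (Suc n) s"
      "\<forall>\<^sub>\<approx>s. g' (Suc n) (s + \<omega> (Suc n)) = inverse (g' n s) * g' (Suc n) s"
      using g g' by (auto simp: gamma_hierarchy_def)
    have P': "g n s = exp (poly (smult (2 * pi * \<i>) P) s) * g' n s" if "Re s > 0" for s
      using P that by (simp add: \<Phi>_def)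
    obtain p and k :: int where p: "\<And>s. Re s > 0 \<Longrightarrow> g (Suc n) s = exp (poly p s) * g' (Suc n) s"
      "\<And>s. poly p (s + \<omega> (Suc n)) - poly p s = 2 * pi * \<i> * k - poly (smult (2 * pi * \<i>) P) s"
      using gamma_quotient_step[OF \<omega> LLD(1) fin(1) LLD(2) fin(2) LLD(1,2) P' rec] by blast
    have "g (Suc n) 1 = 1" "g' (Suc n) 1 = 1" using g g' by (auto simp: gamma_hierarchy_def)
    then have p1: "exp (poly p 1) = 1" using p(1)[of 1] by simp
    \<comment> \<open>Normalising to the value 0 at 1 is harmless:
      \<open>exp (poly p 1) = 1\<close>, and constants drop out of the difference equation.\<close>
    define p' where "p' = smult (inverse (2 * pi * \<i>)) (p - [:poly p 1:])"
    have p': "2 * pi * \<i> * poly p' s = poly p s - poly p 1" for s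
    proof -
      have "2 * pi * \<i> * inverse (2 * pi * \<i>) = 1" by (rule right_inverse) simp
      then show ?thesis unfolding p'_def poly_smult mult.assoc[symmetric] by simp
    qed
    have "\<Phi> (Suc n) p'"
      unfolding \<Phi>_def p' using p(1) p1 by (simp add: exp_diff p'_def)
    moreover have "poly p' (s + \<omega> (Suc n)) - poly p' s = of_int k - poly P s" for s
    proof -
      have "2 * pi * \<i> * (poly p' (s + \<omega> (Suc n)) - poly p' s) = 2 * pi * \<i> * (of_int k - poly P s)"
        using p(2)[of s] by (simp only: right_diff_distrib p') (simp add: algebra_simps)
      then show ?thesis by simp
    qed
    then have "\<Psi> n P p'" unfolding \<Psi>_def by blast
    ultimately show "\<exists>p'. \<Phi> (Suc n) p' \<and> \<Psi> n P p'" by blast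
  qed
  then obtain q where q: "\<And>n. \<Phi> n (q n)" "\<And>n. \<Psi> n (q n) (q (Suc n))" by blast
  then obtain k :: "nat \<Rightarrow> int" where
    "\<And>n s. poly (q (Suc n)) (s + \<omega> (Suc n)) - poly (q (Suc n)) s = of_int (k n) - poly (q n) s"
    unfolding \<Psi>_def by metis
  then show thesis using q(1) by (intro that[of q k]) (auto simp: \<Phi>_def)
qed

theorem theorem6p20:
  fixes f :: "complex \<Rightarrow> complex" and \<omega> :: "nat \<Rightarrow> complex"
    and g g' :: "nat \<Rightarrow> complex \<Rightarrow> complex" and N :: nat and r :: real
  assumes "\<forall>j\<ge>1. Re (\<omega> j) > 0"
    and "LLD f" and "mero_finite_order f" and "f 1 = 1"
    and "N \<ge> 1"
    and "\<forall>n. 1 \<le> n \<and> n \<le> N \<longrightarrow> ext_degree_ge (Qadj \<omega> (n - 1)) (\<omega> n) (n + 1)"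
    and "gamma_hierarchy f \<omega> g" and "gamma_hierarchy f \<omega> g'"
    and "r \<in> \<rat>" and "r > 0" and "r \<noteq> 1"
    and "g N (complex_of_real r) = g' N (complex_of_real r)"
  shows "\<forall>n. 1 \<le> n \<and> n \<le> N \<longrightarrow> (\<forall>\<^sub>\<approx>s. g n s = g' n s)"
proof -
  have \<omega>: "Re (\<omega> (Suc n)) > 0" for n using assms(1) by simp
  then have \<omega>0: "\<omega> (Suc n) \<noteq> 0" for n by (metis less_irrefl zero_complex.sel(1))
  obtain q :: "nat \<Rightarrow> complex poly" and k :: "nat \<Rightarrow> int" where q: "q 0 = 0" "\<And>n. poly (q n) 1 = 0"
    "\<And>n s. Re s > 0 \<Longrightarrow> g n s = exp (2 * pi * \<i> * poly (q n) s) * g' n s"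
    "\<And>n s. poly (q (Suc n)) (s + \<omega> (Suc n)) - poly (q (Suc n)) s = of_int (k n) - poly (q n) s"
    using gamma_hierarchy_quotient[OF \<omega> assms(7,8)] by blast
  have deg: "ext_degree_ge (Qadj \<omega> n) (\<omega> (Suc n)) (Suc (Suc n))" if "n < N" for n
    using assms(6) that by (auto dest!: spec[of _ "Suc n"])
  have "g' N r \<noteq> 0" using assms(8,10) by (simp add: gamma_hierarchy_def LLD_def)
  then have one: "exp (2 * pi * \<i> * poly (q N) r) = 1"
    using q(3)[of r N] assms(10,12) by simp
  \<comment> \<open>A single point is connected, so the lemma on continuous logarithms of 1 yields
    the integer.\<close>
  obtain m :: int where "2 * pi * \<i> * poly (q N) r = 2 * pi * \<i> * m"
    using exp_eq_1_continuous_constant[of "{0::complex}" "\<lambda>_. 2 * pi * \<i> * poly (q N) r"] one by auto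
  then have int: "poly (q N) r \<in> \<int>" by simp
  have rat: "complex_of_real r \<in> \<rat>"
    using assms(9) by (auto elim!: Rats_cases)
  have "q n = 0" if "n \<le> N" for n
    by (rule difference_hierarchy_trivial[OF \<omega>0 deg q(1,2,4) rat _ int that]) (use assms(11) in auto)
  then have "g n s = g' n s" if "n \<le> N" "Re s > 0" for n s
    using q(3)[of s n] that by simp
  then show ?thesis
    using assms(7,8) by (auto simp: gamma_hierarchy_def mero_finite_order_def intro!: meromorphic_eq_if_eq_halfspace)
qed

end
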